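(* Assume the standing setup, where $b$ is given by \[ b(t)=\frac{\sigma(t)^2}{2\left(K\int_0^t\sigma(s)^2\,\mathrm{d} s+C\right)},\qquad t\in[0,T), \] for constants $K,C\in\mathbb{R}$ with $K\int_0^t\sigma(s)^2\,\mathrm{d} s+C\neq0$ for all $t\in[0,T)$. Then for all $\alpha\in\mathbb{R}$, $\mu>0$, $\nu\ge0$ and $t\in[0,T)$, writing $D:=\sqrt{2\mu+(\alpha-K)^2}$ and $L:=\ln(B_{K,C}(t))$, \[ \mathsf{E}\exp\left\{-\mu\int_0^t\frac{b(s)^2}{\sigma(s)^2}(X^{(\alpha)}_s)^2\,\mathrm{d} s-\nu(X^{(\alpha)}_t)^2\right\} =\frac{B_{K,C}(t)^{\frac{K-\alpha}{4}}}{\sqrt{\cosh\left(\frac{D}{2}L\right)-\frac{\alpha-K-4\nu\left(K\int_0^t\sigma(s)^2\,\mathrm{d} s+C\right)}{D}\sinh\left(\frac{D}{2}L\right)}}. \]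
   Context: Standing setup: $T\in(0,\infty]$; $b:[0,T)\to\mathbb{R}\setminus\{0\}$ and $\sigma:[0,T)\to(0,\infty)$ are continuously differentiable; $(B_t)_{t\in[0,T)}$ is a standard Wiener process. For $\alpha\in\mathbb{R}$, $(X^{(\alpha)}_t)_{t\in[0,T)}$ is the unique strong solution of $\mathrm{d} X^{(\alpha)}_t=\alpha b(t)X^{(\alpha)}_t\,\mathrm{d} t+\sigma(t)\,\mathrm{d} B_t$, $X^{(\alpha)}_0=0$. Define $B_{K,C}(t):=\left(1+\frac{K}{C}\int_0^t\sigma(s)^2\,\mathrm{d} s\right)^{1/K}$ if $K\neq0$ and $B_{K,C}(t):=\exp\{\frac1C\int_0^t\sigma(s)^2\,\mathrm{d} s\}$ if $K=0$, for $t\in[0,T)$ (this is positive). *)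

theory Defs
  imports "HOL-Probability.Probability"
begin

definition time_set :: "ereal \<Rightarrow> real set" where
  "time_set T = {t. 0 \<le> t \<and> ereal t < T}"

definition sigma_int :: "(real \<Rightarrow> real) \<Rightarrow> real \<Rightarrow> real" where
  "sigma_int \<sigma> t = integral {0..t} (\<lambda>s. (\<sigma> s)^2)"

definition B_KC :: "real \<Rightarrow> real \<Rightarrow> (real \<Rightarrow> real) \<Rightarrow> real \<Rightarrow> real" where
  "B_KC K C \<sigma> t =
     (if K \<noteq> 0 then (1 + K / C * sigma_int \<sigma> t) powr (1 / K)
      else exp (sigma_int \<sigma> t / C))"

definition wiener_process :: "'a measure \<Rightarrow> real set \<Rightarrow> (real \<Rightarrow> 'a \<Rightarrow> real) \<Rightarrow> bool" where
  "wiener_process M I W \<longleftrightarrow>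
     prob_space M \<and>
     (\<forall>t\<in>I. W t \<in> borel_measurable M) \<and>
     (\<forall>\<omega>\<in>space M. W 0 \<omega> = 0) \<and>
     (\<forall>\<omega>\<in>space M. continuous_on I (\<lambda>t. W t \<omega>)) \<and>
     (\<forall>ts. sorted_wrt (<) ts \<and> set ts \<subseteq> I \<longrightarrow>
        prob_space.indep_vars M (\<lambda>_. borel)
          (\<lambda>i \<omega>. W (ts ! Suc i) \<omega> - W (ts ! i) \<omega>) {..<length ts - 1}) \<and>
     (\<forall>s\<in>I. \<forall>t\<in>I. s < t \<longrightarrow>
        distributed M lborel (\<lambda>\<omega>. W t \<omega> - W s \<omega>) (normal_density 0 (sqrt (t - s))))"

text \<open>Wiener integral of a C^1 deterministic integrand sigma (with derivative
  sigma') against W, defined pathwise via integration by parts: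
  int_0^t sigma dW = sigma(t) W_t - int_0^t sigma'(s) W_s ds.\<close>
definition wiener_integral ::
    "(real \<Rightarrow> real) \<Rightarrow> (real \<Rightarrow> real) \<Rightarrow> (real \<Rightarrow> 'a \<Rightarrow> real) \<Rightarrow> real \<Rightarrow> 'a \<Rightarrow> real" where
  "wiener_integral \<sigma> \<sigma>' W t \<omega> = \<sigma> t * W t \<omega> - integral {0..t} (\<lambda>s. \<sigma>' s * W s \<omega>)"

definition linear_sde_solution ::
    "'a measure \<Rightarrow> real set \<Rightarrow> (real \<Rightarrow> real) \<Rightarrow> (real \<Rightarrow> real) \<Rightarrow> (real \<Rightarrow> real)
     \<Rightarrow> (real \<Rightarrow> 'a \<Rightarrow> real) \<Rightarrow> (real \<Rightarrow> 'a \<Rightarrow> real) \<Rightarrow> bool" where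
  "linear_sde_solution M I a \<sigma> \<sigma>' W X \<longleftrightarrow>
     (\<forall>t\<in>I. X t \<in> borel_measurable M) \<and>
     (\<forall>\<omega>\<in>space M. continuous_on I (\<lambda>t. X t \<omega>)) \<and>
     (AE \<omega> in M. \<forall>t\<in>I.
        X t \<omega> = integral {0..t} (\<lambda>s. a s * X s \<omega>) + wiener_integral \<sigma> \<sigma>' W t \<omega>)"

end

theory Submission
  imports Defs
begin

text \<open>
  Put \<open>G s = K * sigma_int \<sigma> s + C\<close>, let \<open>L\<close> be the logarithm of \<open>B_KC\<close>, so that
  \<open>L' = \<sigma>\<^sup>2 / G = 2 * b\<close>, and let \<open>A = exp (\<alpha> / 2 * L)\<close>.
  Pathwise variation of constants gives \<open>X = A * N\<close>, where \<open>N\<close> is the Wiener integral of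
  \<open>\<phi> = \<sigma> / A\<close>. If \<open>P\<close> solves the Riccati equation
  \<open>P' = 2 * \<phi>\<^sup>2 * P\<^sup>2 - m\<close>, the expectation of
  \<open>exp (- \<integral> m * N\<^sup>2 - P t * N\<^sub>t\<^sup>2)\<close> equals
  \<open>exp (- \<integral> \<phi>\<^sup>2 * P)\<close>.
  No stochastic calculus is needed for this: on a uniform grid \<open>N\<close> is replaced by a
  random walk with Gaussian steps, and the weights of the discrete quadratic form are chosen such that the
  values of \<open>P\<close> at the grid points solve the discrete Riccati recursion without any error. The
  discrete expectation is then an explicit product, the weights divided by the mesh converge
  uniformly to \<open>m\<close>, and, as \<open>m > 0\<close>, dominated convergence with the bound 1 applies.
\<close>

section \<open>Limits along uniform grids\<close>

text \<open>Convergence is uniform in the grid index, so that sums of \<open>n\<close> terms with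
  weight \<open>t / real n\<close> inherit it. The range \<open>i < n\<close> lists the left end
  points of the cells.\<close>

definition grid_lim :: "real \<Rightarrow> (nat \<Rightarrow> nat \<Rightarrow> real) \<Rightarrow> (real \<Rightarrow> real) \<Rightarrow> bool" where
  "grid_lim t a f \<longleftrightarrow>
     (\<forall>e>0. \<forall>\<^sub>F n in sequentially. \<forall>i<n. \<bar>a n i - f (real i * t / real n)\<bar> < e)"

lemma grid_limD:
  "grid_lim t a f \<Longrightarrow> e > 0 \<Longrightarrow>
     \<forall>\<^sub>F n in sequentially. \<forall>i<n. \<bar>a n i - f (real i * t / real n)\<bar> < e"
  by (simp add: grid_lim_def)

lemma grid_point_mem: "t \<ge> 0 \<Longrightarrow> i \<le> n \<Longrightarrow> real i * t / real n \<in> {0..t}"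
  by (cases "n = 0") (auto simp: field_simps intro!: mult_left_mono)

lemma grid_step: "n > 0 \<Longrightarrow> real (Suc i) * t / real n - real i * t / real n = t / real n"
  by (simp add: field_simps)

lemma grid_lim_point: "grid_lim t (\<lambda>n i. f (real i * t / real n)) f"
  by (simp add: grid_lim_def)

lemma grid_lim_mesh: "grid_lim t (\<lambda>n i. t / real n) (\<lambda>_. 0)"
proof -
  have "(\<lambda>n. t / real n) \<longlonglongrightarrow> 0" by (rule lim_const_over_n)
  then show ?thesis
    unfolding grid_lim_def tendsto_iff dist_real_def by (auto elim: eventually_mono)
qed

lemma eventually_mesh_small:
  assumes "d > 0" shows "\<forall>\<^sub>F n in sequentially. n > 0 \<and> \<bar>t / real n\<bar> < d"
proof -
  have "(\<lambda>n. t / real n) \<longlonglongrightarrow> 0" by (rule lim_const_over_n)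
  from tendstoD[OF this assms] eventually_gt_at_top[of 0] show ?thesis
    by eventually_elim (auto simp: dist_real_def)
qed

text \<open>Uniform continuity on the compact interval: once the mesh is small, a cell lies within
  the modulus of its left end point. Admitting every \<open>z\<close> of the cell serves both the
  right end point and the intermediate points supplied by the mean value theorem.\<close>

lemma grid_lim_uniformly:
  fixes f :: "real \<Rightarrow> real"
  assumes t: "t \<ge> 0" and f: "continuous_on {0..t} f" and e: "e > 0"
  shows "\<forall>\<^sub>F n in sequentially. \<forall>i<n. \<forall>z\<in>{real i * t / real n .. real (Suc i) * t / real n}.
           \<bar>f z - f (real i * t / real n)\<bar> < e"
proof -
  have "uniformly_continuous_on {0..t} f"
    using f by (intro compact_uniformly_continuous) auto
  then obtain d where d: "d > 0"
    "\<And>x y. x \<in> {0..t} \<Longrightarrow> y \<in> {0..t} \<Longrightarrow> dist y x < d \<Longrightarrow> dist (f y) (f x) < e"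
    using e unfolding uniformly_continuous_on_def by metis
  from eventually_mesh_small[OF d(1), of t] show ?thesis
  proof eventually_elim
    case (elim n)
    show ?case
    proof (intro allI impI ballI)
      fix i z assume i: "i < n" and z: "z \<in> {real i * t / real n .. real (Suc i) * t / real n}"
      have m: "real i * t / real n \<in> {0..t}" "real (Suc i) * t / real n \<in> {0..t}"
        using i t by (auto intro!: grid_point_mem simp del: atLeastAtMost_iff of_nat_Suc)
      have "z \<in> {0..t}" using z m by auto
      moreover have "dist z (real i * t / real n) < d"
        using z elim grid_step[of n i t] t by (auto simp: dist_real_def simp del: of_nat_Suc)
      ultimately show "\<bar>f z - f (real i * t / real n)\<bar> < e"
        using d(2)[OF m(1)] by (simp add: dist_real_def)
    qed
  qed
qed

lemma grid_lim_shift: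
  assumes "t \<ge> 0" "continuous_on {0..t} f"
  shows "grid_lim t (\<lambda>n i. f (real (Suc i) * t / real n)) f"
  unfolding grid_lim_def
proof (intro allI impI)
  fix e :: real assume "e > 0"
  from grid_lim_uniformly[OF assms this]
  show "\<forall>\<^sub>F n in sequentially. \<forall>i<n.
      \<bar>f (real (Suc i) * t / real n) - f (real i * t / real n)\<bar> < e"
  proof eventually_elim
    case (elim n)
    have "real i * t / real n \<le> real (Suc i) * t / real n" for i
      using assms by (intro divide_right_mono mult_right_mono) auto
    then show ?case using elim by (simp del: of_nat_Suc)
  qed
qed

text \<open>By the mean value theorem each quotient is a value of \<open>f'\<close> inside the cell,
  and \<open>f'\<close> oscillates uniformly little on cells.\<close>

lemma grid_lim_difference_quotient:
  assumes t: "t > 0"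
    and f: "\<And>s. s \<in> {0..t} \<Longrightarrow> (f has_real_derivative f' s) (at s within {0..t})"
    and f': "continuous_on {0..t} f'"
  shows "grid_lim t (\<lambda>n i. (f (real (Suc i) * t / real n) - f (real i * t / real n)) / (t / real n)) f'"
  unfolding grid_lim_def
proof (intro allI impI)
  fix e :: real assume e: "e > 0"
  have t0: "t \<ge> 0" using t by simp
  from grid_lim_uniformly[OF t0 f' e]
  show "\<forall>\<^sub>F n in sequentially. \<forall>i<n.
      \<bar>(f (real (Suc i) * t / real n) - f (real i * t / real n)) / (t / real n)
        - f' (real i * t / real n)\<bar> < e"
  proof eventually_elim
    case (elim n)
    show ?case
    proof (intro allI impI)
      fix i assume i: "i < n"
      define x y where "x = real i * t / real n" and "y = real (Suc i) * t / real n"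
      have step: "y - x = t / real n" using grid_step[of n i t] i by (simp add: x_def y_def)
      have m: "x \<in> {0..t}" "y \<in> {0..t}" unfolding x_def y_def
        using i t0 by (auto intro!: grid_point_mem simp del: atLeastAtMost_iff of_nat_Suc)
      have pos: "t / real n > 0" using t i by simp
      have "\<exists>z\<in>{x..y}. f y - f x = f' z * (y - x)"
      proof (rule mvt_very_simple)
        show "x \<le> y" using step pos by linarith
        fix z assume "x \<le> z" "z \<le> y"
        then have "(f has_real_derivative f' z) (at z within {x..y})"
          using m by (intro DERIV_subset[OF f]) auto
        then show "(f has_derivative (*) (f' z)) (at z within {x..y})"
          by (simp add: has_field_derivative_def)
      qed
      then obtain z where z: "z \<in> {x..y}" "f y - f x = f' z * (t / real n)"
        using step by auto
      have "(f y - f x) / (t / real n) = f' z" unfolding z(2) by (rule nonzero_mult_div_cancel_right) (rule less_imp_neq[OF pos, symmetric])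
      moreover have "\<bar>f' z - f' x\<bar> < e" using elim i z(1) by (simp add: x_def y_def)
      ultimately show "\<bar>(f (real (Suc i) * t / real n) - f (real i * t / real n)) / (t / real n)
        - f' (real i * t / real n)\<bar> < e" by (simp add: x_def y_def)
    qed
  qed
qed

section \<open>Arithmetic of grid limits\<close>

lemma grid_lim_add:
  assumes "grid_lim t a f" "grid_lim t b g"
  shows "grid_lim t (\<lambda>n i. a n i + b n i) (\<lambda>s. f s + g s)"
  unfolding grid_lim_def
proof (intro allI impI)
  fix e :: real assume "e > 0"
  then have e: "e / 2 > 0" by simp
  from grid_limD[OF assms(1) e] grid_limD[OF assms(2) e]
  show "\<forall>\<^sub>F n in sequentially. \<forall>i<n. \<bar>a n i + b n i -
      (f (real i * t / real n) + g (real i * t / real n))\<bar> < e"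
    proof eventually_elim
    case (elim n)
    show ?case
    proof (intro allI impI)
      fix i assume "i < n"
      with elim have "\<bar>a n i - f (real i * t / real n)\<bar> < e / 2"
        "\<bar>b n i - g (real i * t / real n)\<bar> < e / 2" by auto
      then show "\<bar>a n i + b n i - (f (real i * t / real n) + g (real i * t / real n))\<bar> < e" by linarith
    qed
  qed
qed

lemma grid_lim_minus:
  assumes "grid_lim t a f"
  shows "grid_lim t (\<lambda>n i. - a n i) (\<lambda>s. - f s)"
proof -
  have "\<bar>- x - - y\<bar> = \<bar>x - y\<bar>" for x y :: real by arith
  then show ?thesis using assms unfolding grid_lim_def by simp
qed

lemma continuous_on_interval_bounded:
  fixes f :: "real \<Rightarrow> real"
  assumes "continuous_on {a..b} f"
  obtains B where "B \<ge> 0" "\<And>s. s \<in> {a..b} \<Longrightarrow> \<bar>f s\<bar> \<le> B"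
proof -
  have "bounded (f ` {a..b})"
    using assms by (intro compact_imp_bounded compact_continuous_image) auto
  then obtain B where "B > 0" "\<forall>y\<in>f ` {a..b}. norm y \<le> B" unfolding bounded_pos by blast
  then show ?thesis using that[of B] by auto
qed

lemma grid_lim_mult:
  assumes t: "t \<ge> 0" and a: "grid_lim t a f" and b: "grid_lim t b g"
    and f: "continuous_on {0..t} f" and g: "continuous_on {0..t} g"
  shows "grid_lim t (\<lambda>n i. a n i * b n i) (\<lambda>s. f s * g s)"
  unfolding grid_lim_def
proof (intro allI impI)
  fix e :: real assume e: "e > 0"
  obtain F where F: "F \<ge> 0" "\<And>s. s \<in> {0..t} \<Longrightarrow> \<bar>f s\<bar> \<le> F"
    using continuous_on_interval_bounded[OF f] by blast
  obtain G where G: "G \<ge> 0" "\<And>s. s \<in> {0..t} \<Longrightarrow> \<bar>g s\<bar> \<le> G"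
    using continuous_on_interval_bounded[OF g] by blast
  \<comment> \<open>The error of the product is at most \<open>d * d + d * G + F * d\<close>. With
    \<open>d \<le> 1\<close> this is at most \<open>d * (1 + F + G)\<close>, and the 2 in place of 1
    makes the final inequality strict.\<close>
  define d where "d = min 1 (e / (2 + F + G))"
  have d: "d > 0" "d \<le> 1" "d * (2 + F + G) \<le> e"
  proof -
    have pos: "2 + F + G > 0" using F G by simp
    then show "d > 0" "d \<le> 1" using e by (simp_all add: d_def)
    have "d \<le> e / (2 + F + G)" by (simp add: d_def)
    then show "d * (2 + F + G) \<le> e" using pos by (simp only: pos_le_divide_eq)
  qed
  from grid_limD[OF a d(1)] grid_limD[OF b d(1)]
  show "\<forall>\<^sub>F n in sequentially. \<forall>i<n. \<bar>a n i * b n i -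
      f (real i * t / real n) * g (real i * t / real n)\<bar> < e"
  proof eventually_elim
    case (elim n)
    show ?case
    proof (intro allI impI)
      fix i assume i: "i < n"
      let ?x = "real i * t / real n"
      have x: "?x \<in> {0..t}" using grid_point_mem[of t i n] t i by simp
      have A: "\<bar>a n i - f ?x\<bar> < d" and B: "\<bar>b n i - g ?x\<bar> < d" using elim i by auto
      have "\<bar>a n i * b n i - f ?x * g ?x\<bar> =
          \<bar>(a n i - f ?x) * (b n i - g ?x) + (a n i - f ?x) * g ?x + f ?x * (b n i - g ?x)\<bar>"
        by (simp add: algebra_simps)
      also have "\<dots> \<le> \<bar>a n i - f ?x\<bar> * \<bar>b n i - g ?x\<bar> + \<bar>a n i - f ?x\<bar> * \<bar>g ?x\<bar> + \<bar>f ?x\<bar> * \<bar>b n i - g ?x\<bar>"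
      proof -
        have "\<bar>u + v + w\<bar> \<le> \<bar>u\<bar> + \<bar>v\<bar> + \<bar>w\<bar>" for u v w :: real by arith
        then show ?thesis unfolding abs_mult[symmetric] by blast
      qed
      also have "\<dots> \<le> d * 1 + d * G + F * d"
        using less_imp_le[OF A] less_imp_le[OF B] order_trans[OF less_imp_le[OF B] d(2)]
          F(1) G(1) F(2)[OF x] G(2)[OF x] less_imp_le[OF d(1)]
        by (intro add_mono mult_mono) (simp_all only: abs_ge_zero zero_le_one)
      also have "\<dots> < d * (2 + F + G)" using d by (simp add: algebra_simps)
      also have "\<dots> \<le> e" by fact
      finally show "\<bar>a n i * b n i - f ?x * g ?x\<bar> < e" .
    qed
  qed
qed

lemma grid_lim_cong:
  assumes "grid_lim t a f" "\<And>s. s \<in> {0..t} \<Longrightarrow> f s = g s" "t \<ge> 0"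
    "\<forall>\<^sub>F n in sequentially. \<forall>i<n. a n i = b n i"
  shows "grid_lim t b g"
  unfolding grid_lim_def
proof (intro allI impI)
  fix e :: real assume "e > 0"
  from grid_limD[OF assms(1) this] assms(4)
  show "\<forall>\<^sub>F n in sequentially. \<forall>i<n. \<bar>b n i - g (real i * t / real n)\<bar> < e"
  proof eventually_elim
    case (elim n)
    show ?case
    proof (intro allI impI)
      fix i assume "i < n"
      with elim assms(2)[OF grid_point_mem[OF assms(3), of i n]]
      show "\<bar>b n i - g (real i * t / real n)\<bar> < e" by auto
    qed
  qed
qed

text \<open>Comparing a sum with the increments of the antiderivative of the limit makes the
  error uniform in the upper summation bound.\<close>
lemma grid_lim_sum_uniform:
  assumes t: "t > 0" and a: "grid_lim t a f" and f: "continuous_on {0..t} f" and e: "e > 0"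
  shows "\<forall>\<^sub>F n in sequentially. \<forall>k\<le>n.
    \<bar>(\<Sum>i<k. t / real n * a n i) - integral {0..real k * t / real n} f\<bar> < e"
proof -
  define F where "F = (\<lambda>x. integral {0..x} f)"
  have F: "(F has_real_derivative f s) (at s within {0..t})" if "s \<in> {0..t}" for s
    unfolding F_def using f that by (rule integral_has_real_derivative)
  \<comment> \<open>Each of the at most \<open>n\<close> summands will err by at most
    \<open>t / real n * d\<close>, so the total error is at most \<open>t * d = e / 2\<close>,
    whatever \<open>k\<close> is.\<close>
  define d where "d = e / (2 * t)"
  have d: "d > 0" "2 * t * d = e" using e t by (auto simp: d_def)
  have t0: "t \<ge> 0" using t by simp
  have Fq: "grid_lim t (\<lambda>n i. (F (real (Suc i) * t / real n) - F (real i * t / real n)) / (t / real n)) f"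
    using t F f by (rule grid_lim_difference_quotient)
  have d4: "d / 2 > 0" using d by simp
  from grid_limD[OF a d4] grid_limD[OF Fq d4] eventually_gt_at_top[of 0]
  show ?thesis
  proof eventually_elim
    case (elim n)
    let ?x = "\<lambda>i. real i * t / real n"
    have step: "\<bar>t / real n * a n i - (F (?x (Suc i)) - F (?x i))\<bar> \<le> t / real n * d" if "i < n" for i
    proof -
      have "\<bar>a n i - (F (?x (Suc i)) - F (?x i)) / (t / real n)\<bar> \<le> d"
        using elim(1)[rule_format, OF that] elim(2)[rule_format, OF that] by linarith
      then have "t / real n * \<bar>a n i - (F (?x (Suc i)) - F (?x i)) / (t / real n)\<bar> \<le> t / real n * d"
        using t by (intro mult_left_mono) auto
      also have "t / real n * \<bar>a n i - (F (?x (Suc i)) - F (?x i)) / (t / real n)\<bar>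
          = \<bar>t / real n * (a n i - (F (?x (Suc i)) - F (?x i)) / (t / real n))\<bar>"
        using t by (simp add: abs_mult)
      also have "t / real n * (a n i - (F (?x (Suc i)) - F (?x i)) / (t / real n))
          = t / real n * a n i - (F (?x (Suc i)) - F (?x i))"
      proof -
        have "h * (x - y / h) = h * x - y" if "h \<noteq> 0" for h x y :: real
          using that by (simp add: right_diff_distrib)
        moreover have "t / real n \<noteq> 0" using t elim(3) by simp
        ultimately show ?thesis by blast
      qed
      finally show ?thesis .
    qed
    show ?case
    proof (intro allI impI)
      fix k assume k: "k \<le> n"
      have "F 0 = 0" by (simp add: F_def)
      then have "F (?x k) = (\<Sum>i<k. F (?x (Suc i)) - F (?x i))"
        using sum_lessThan_telescope[of "\<lambda>i. F (?x i)" k] by simp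
      then have "\<bar>(\<Sum>i<k. t / real n * a n i) - F (?x k)\<bar>
          = \<bar>\<Sum>i<k. t / real n * a n i - (F (?x (Suc i)) - F (?x i))\<bar>"
        by (simp add: sum_subtractf)
      also have "\<dots> \<le> (\<Sum>i<k. \<bar>t / real n * a n i - (F (?x (Suc i)) - F (?x i))\<bar>)"
        by (rule sum_abs)
      also have "\<dots> \<le> (\<Sum>i<k. t / real n * d)"
        using k by (intro sum_mono step) auto
      also have "\<dots> = ?x k * d" by simp
      also have "\<dots> \<le> t * d"
        using grid_point_mem[OF t0 k] d by (intro mult_right_mono) auto
      also have "\<dots> < e" using d(2) e by linarith
      finally show "\<bar>(\<Sum>i<k. t / real n * a n i) - integral {0..?x k} f\<bar> < e" by (simp add: F_def)
    qed
  qed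
qed

lemma grid_lim_sum:
  assumes t: "t > 0" and a: "grid_lim t a f" and f: "continuous_on {0..t} f"
  shows "(\<lambda>n. \<Sum>i<n. t / real n * a n i) \<longlonglongrightarrow> integral {0..t} f"
proof (rule tendstoI)
  fix e :: real assume "e > 0"
  from grid_lim_sum_uniform[OF assms this] eventually_gt_at_top[of 0]
  show "\<forall>\<^sub>F n in sequentially. dist (\<Sum>i<n. t / real n * a n i) (integral {0..t} f) < e"
    by eventually_elim (auto simp: dist_real_def)
qed

text \<open>This transfers a limit between families whose difference is controlled uniformly, such
  as \<open>ln (1 + q * h) / h\<close> against \<open>q\<close> for mesh \<open>h\<close>, or
  \<open>1 / r\<close> against 1.\<close>

lemma grid_lim_squeeze:
  assumes a: "grid_lim t a f" and d: "grid_lim t d (\<lambda>_. 0)"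
    and le: "\<forall>\<^sub>F n in sequentially. \<forall>i<n. \<bar>b n i - a n i\<bar> \<le> d n i"
  shows "grid_lim t b f"
  unfolding grid_lim_def
proof (intro allI impI)
  fix e :: real assume "e > 0"
  then have e: "e / 2 > 0" by simp
  from grid_limD[OF a e] grid_limD[OF d e] le
  show "\<forall>\<^sub>F n in sequentially. \<forall>i<n. \<bar>b n i - f (real i * t / real n)\<bar> < e"
  proof eventually_elim
    case (elim n)
    show ?case
    proof (intro allI impI)
      fix i assume "i < n"
      with elim have "\<bar>a n i - f (real i * t / real n)\<bar> < e / 2" "\<bar>d n i\<bar> < e / 2"
        "\<bar>b n i - a n i\<bar> \<le> d n i" by auto
      then show "\<bar>b n i - f (real i * t / real n)\<bar> < e" by linarith
    qed
  qed
qed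

lemma grid_lim_mult_mesh:
  assumes "t \<ge> 0" "grid_lim t a f" "continuous_on {0..t} f"
  shows "grid_lim t (\<lambda>n i. a n i * (t / real n)) (\<lambda>_. 0)"
  using grid_lim_mult[OF assms(1,2) grid_lim_mesh assms(3)] by simp

text \<open>For \<open>z = q * h \<ge> 0\<close> with mesh \<open>h\<close>, the bounds
  \<open>z - z * z \<le> ln (1 + z) \<le> z\<close> leave an error of at most
  \<open>q * q * h\<close> after division by \<open>h\<close>. This turns the logarithm of a product
  over the grid into a Riemann sum.\<close>

lemma grid_lim_ln:
  assumes t: "t > 0" and q: "grid_lim t q f" and f: "continuous_on {0..t} f"
    and q0: "\<And>n i. i < n \<Longrightarrow> q n i \<ge> 0"
  shows "grid_lim t (\<lambda>n i. ln (1 + q n i * (t / real n)) / (t / real n)) f"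
proof (rule grid_lim_squeeze[OF q])
  have t0: "t \<ge> 0" using t by simp
  show "grid_lim t (\<lambda>n i. q n i * q n i * (t / real n)) (\<lambda>_. 0)"
    by (rule grid_lim_mult_mesh[OF t0 grid_lim_mult[OF t0 q q f f]]) (intro continuous_intros f)
  have "\<bar>ln (1 + q n i * (t / real n)) / (t / real n) - q n i\<bar> \<le> q n i * q n i * (t / real n)"
    if i: "i < n" for n i
  proof -
    define h where "h = t / real n"
    have h: "h > 0" using t i by (simp add: h_def)
    define z where "z = q n i * h"
    have z: "z \<ge> 0" using q0[OF i] h by (simp add: z_def)
    have up: "ln (1 + z) \<le> z" using z by (rule ln_add_one_self_le_self)
    \<comment> \<open>The lower bound for the logarithm comes from the upper bound
      \<open>ln y \<le> y - 1\<close> at the reciprocal.\<close>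
    have "ln (inverse (1 + z)) \<le> inverse (1 + z) - 1" using z by (intro ln_le_minus_one) auto
    then have "ln (1 + z) \<ge> 1 - inverse (1 + z)" using z by (simp add: ln_inverse)
    also have "1 - inverse (1 + z) = z / (1 + z)" using z by (simp add: field_simps)
    finally have "ln (1 + z) \<ge> z / (1 + z)" .
    moreover have "z / (1 + z) \<ge> z - z * z"
    proof -
      have "(z - z * z) * (1 + z) = z - z * z * z" by (simp add: algebra_simps)
      also have "\<dots> \<le> z" using z by simp
      finally show ?thesis using z by (simp add: pos_le_divide_eq)
    qed
    ultimately have "\<bar>ln (1 + z) - z\<bar> \<le> z * z" using up by linarith
    then have "\<bar>ln (1 + z) - z\<bar> / h \<le> z * z / h" using h by (intro divide_right_mono) auto
    moreover have "\<bar>ln (1 + z) - z\<bar> / h = \<bar>ln (1 + z) / h - q n i\<bar>"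
    proof -
      have "ln (1 + z) / h - q n i = (ln (1 + z) - z) / h" using h by (simp add: z_def field_simps)
      then show ?thesis using h by (simp add: abs_divide)
    qed
    moreover have "z * z / h = q n i * q n i * h" using h by (simp add: z_def)
    ultimately show ?thesis by (simp add: z_def h_def)
  qed
  then show "\<forall>\<^sub>F n in sequentially. \<forall>i<n.
      \<bar>ln (1 + q n i * (t / real n)) / (t / real n) - q n i\<bar> \<le> q n i * q n i * (t / real n)"
    by (intro always_eventually allI impI)
qed

section \<open>Quadratic functionals of Gaussian random walks\<close>

lemma nn_integral_normal_density:
  "s > 0 \<Longrightarrow> (\<integral>\<^sup>+y. ennreal (normal_density \<mu> s y) \<partial>lborel) = 1"
  by (subst nn_integral_eq_integral) (auto intro: integrable_normal_density)

text \<open>Completing the square in \<open>y\<close>: the precision \<open>1 / s^2\<close> grows to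
  \<open>1 / s^2 + 2 * p * f^2 = r / s^2\<close>, which gives the new standard deviation
  \<open>s / sqrt r\<close>. The factor \<open>1 / sqrt r\<close> repairs the normalisation.\<close>

lemma normal_density_times_exp_square:
  fixes s p f x y :: real
  assumes s: "s > 0" and p: "p \<ge> 0"
  defines "r \<equiv> 1 + 2 * p * f\<^sup>2 * s\<^sup>2"
  shows "normal_density 0 s y * exp (- p * (x + f * y)\<^sup>2)
    = 1 / sqrt r * exp (- p / r * x\<^sup>2)
        * normal_density (- 2 * p * f * x * s\<^sup>2 / r) (s / sqrt r) y"
proof -
  have r: "r > 0" unfolding r_def using p by (simp add: add_pos_nonneg)
  have sq: "(s / sqrt r)\<^sup>2 = s\<^sup>2 / r" using r by (simp add: power_divide)
  have "sqrt (2 * pi * s\<^sup>2) = sqrt r * sqrt (2 * pi * (s\<^sup>2 / r))"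
    using r by (simp flip: real_sqrt_mult)
  then have A: "1 / sqrt r * (1 / sqrt (2 * pi * (s\<^sup>2 / r))) = 1 / sqrt (2 * pi * s\<^sup>2)" by simp
  have "- (y - 0)\<^sup>2 / (2 * s\<^sup>2) + - p * (x + f * y)\<^sup>2
     = - p / r * x\<^sup>2 + - (y - (- 2 * p * f * x * s\<^sup>2 / r))\<^sup>2 / (2 * (s\<^sup>2 / r))"
  proof -
    have "- (y - (- 2 * p * f * x * s\<^sup>2 / r))\<^sup>2 / (2 * (s\<^sup>2 / r))
        = - (r * y + 2 * p * f * x * s\<^sup>2)\<^sup>2 / (2 * s\<^sup>2 * r)"
    proof -
      have "y - (- 2 * p * f * x * s\<^sup>2 / r) = (r * y + 2 * p * f * x * s\<^sup>2) / r"
        using r by (simp add: field_simps)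
      then show ?thesis using r s by (simp add: power2_eq_square)
    qed
    moreover have "- p / r * x\<^sup>2 = - (2 * s\<^sup>2 * p * x\<^sup>2) / (2 * s\<^sup>2 * r)"
      using r s by (simp add: field_simps)
    moreover have "- (y - 0)\<^sup>2 / (2 * s\<^sup>2) + - p * (x + f * y)\<^sup>2
        = - (r * y\<^sup>2 + 2 * s\<^sup>2 * r * p * (x + f * y)\<^sup>2) / (2 * s\<^sup>2 * r)"
      using r s by (simp add: field_simps)
    moreover have "r * y\<^sup>2 + 2 * s\<^sup>2 * r * p * (x + f * y)\<^sup>2
        = 2 * s\<^sup>2 * p * x\<^sup>2 + (r * y + 2 * p * f * x * s\<^sup>2)\<^sup>2"
      unfolding r_def by (simp add: power2_eq_square algebra_simps)
    ultimately show ?thesis by (simp add: diff_divide_distrib)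
  qed
  then show ?thesis
    unfolding normal_density_def sq A[symmetric] by (simp add: exp_add[symmetric])
qed

text \<open>Integrating out one Gaussian step leaves an exponential of the same shape with
  \<open>p\<close> replaced by \<open>p / r\<close>, where \<open>r = 1 + 2 * p * f^2 * s^2\<close>.
  This is the backward step of the discrete Riccati recursion.\<close>

lemma nn_integral_normal_exp_square:
  fixes s p f x :: real
  assumes s: "s > 0" and p: "p \<ge> 0"
  shows "(\<integral>\<^sup>+y. ennreal (normal_density 0 s y) * ennreal (exp (- p * (x + f * y)\<^sup>2)) \<partial>lborel)
    = ennreal (1 / sqrt (1 + 2 * p * f\<^sup>2 * s\<^sup>2) * exp (- p / (1 + 2 * p * f\<^sup>2 * s\<^sup>2) * x\<^sup>2))"
proof -
  have r: "1 + 2 * p * f\<^sup>2 * s\<^sup>2 > 0" using p by (simp add: add_pos_nonneg)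
  show ?thesis
    using r s unfolding ennreal_mult'[OF normal_density_nonneg, symmetric]
      normal_density_times_exp_square[OF s p]
    by (subst ennreal_mult'[OF mult_nonneg_nonneg])
      (auto simp: nn_integral_cmult nn_integral_normal_density)
qed

text \<open>The weights \<open>c i\<close> make \<open>p\<close> an exact solution of the discrete Riccati recursion, so
  the expectation is a closed product for every grid.\<close>
lemma (in prob_space) nn_integral_exp_quadratic_random_walk:
  fixes D :: "nat \<Rightarrow> 'a \<Rightarrow> real" and f p :: "nat \<Rightarrow> real"
  assumes indep: "indep_vars (\<lambda>_. borel) D {..<n}"
    and D: "\<And>i. i < n \<Longrightarrow> distributed M lborel (D i) (normal_density 0 s)"
    and s: "s > 0" and p: "\<And>i. i \<le> n \<Longrightarrow> p i \<ge> 0"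
  defines "Y \<equiv> \<lambda>k \<omega>. \<Sum>j<k. f j * D j \<omega>"
    and "r \<equiv> \<lambda>i. 1 + 2 * p (Suc i) * (f i)\<^sup>2 * s\<^sup>2"
  defines "c \<equiv> \<lambda>i. p i - p (Suc i) / r i"
  assumes k: "k \<le> n"
  shows "(\<integral>\<^sup>+\<omega>. ennreal (exp (- (\<Sum>i<k. c i * (Y i \<omega>)\<^sup>2) - p k * (Y k \<omega>)\<^sup>2)) \<partial>M)
    = ennreal (\<Prod>i<k. 1 / sqrt (r i))"
  using k
proof (induction k)
  case 0
  show ?case by (simp add: Y_def emeasure_space_1)
next
  case (Suc k)
  then have k: "k < n" by simp
  have meas [measurable]: "D i \<in> borel_measurable M" if "i < n" for i
    using D[OF that] by (simp add: distributed_def)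
  have r: "r i > 0" if "i < n" for i
    using p[of "Suc i"] that by (simp add: r_def add_pos_nonneg)
  \<comment> \<open>Position and accumulated quadratic form at index \<open>k\<close> depend only on
    the increments below \<open>k\<close>, so they are jointly independent of
    \<open>D k\<close>.\<close>
  define G where "G = (\<lambda>v::nat \<Rightarrow> real. (\<Sum>j<k. f j * v j, \<Sum>i\<le>k. c i * (\<Sum>j<i. f j * v j)\<^sup>2))"
  define U where "U = (\<lambda>\<omega>. (Y k \<omega>, \<Sum>i\<le>k. c i * (Y i \<omega>)\<^sup>2))"
  \<comment> \<open>Both variables in \<open>indep_var\<close> take values in one type, so the
    increment is padded with a zero coordinate to match the pair \<open>U\<close>.\<close>
  define V where "V = (\<lambda>\<omega>. (D k \<omega>, 0::real))"
  have G: "G \<in> borel_measurable (PiM {..<k} (\<lambda>_. borel))"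
    unfolding G_def borel_prod[symmetric] by measurable
  have "indep_var borel (G \<circ> (\<lambda>\<omega>. restrict (\<lambda>i. D i \<omega>) {..<k}))
    borel ((\<lambda>v. (v k, 0)) \<circ> (\<lambda>\<omega>. restrict (\<lambda>i. D i \<omega>) {k}))"
    using k by (intro indep_var_compose[OF indep_var_restrict[OF indep]] G) auto
  also have "G \<circ> (\<lambda>\<omega>. restrict (\<lambda>i. D i \<omega>) {..<k}) = U"
    by (auto simp: G_def U_def Y_def fun_eq_iff intro!: sum.cong)
  also have "(\<lambda>v. (v k, 0)) \<circ> (\<lambda>\<omega>. restrict (\<lambda>i. D i \<omega>) {k}) = V"
    by (auto simp: V_def)
  finally have "indep_var borel U borel V" .
  then have U [measurable]: "U \<in> borel_measurable M" and V [measurable]: "V \<in> borel_measurable M"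
    and pair: "distr M (borel \<Otimes>\<^sub>M borel) (\<lambda>\<omega>. (U \<omega>, V \<omega>)) = distr M borel U \<Otimes>\<^sub>M distr M borel V"
    unfolding indep_var_distribution_eq by auto
  interpret V: prob_space "distr M borel V" by (rule prob_space_distr) simp
  define F where "F = (\<lambda>z::(real \<times> real) \<times> real \<times> real.
    ennreal (exp (- snd (fst z))) * ennreal (exp (- p (Suc k) * (fst (fst z) + f k * fst (snd z))\<^sup>2)))"
  have F [measurable]: "F \<in> borel_measurable (borel \<Otimes>\<^sub>M borel)"
    unfolding F_def borel_prod[symmetric] by measurable
  have "(\<integral>\<^sup>+\<omega>. ennreal (exp (- (\<Sum>i<Suc k. c i * (Y i \<omega>)\<^sup>2) - p (Suc k) * (Y (Suc k) \<omega>)\<^sup>2)) \<partial>M)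
      = (\<integral>\<^sup>+\<omega>. F (U \<omega>, V \<omega>) \<partial>M)"
    by (intro nn_integral_cong)
      (simp add: F_def U_def V_def Y_def ennreal_mult'[symmetric] exp_add[symmetric] lessThan_Suc_atMost[symmetric])
  also have "\<dots> = (\<integral>\<^sup>+z. F z \<partial>(distr M borel U \<Otimes>\<^sub>M distr M borel V))"
    unfolding pair[symmetric] by (subst nn_integral_distr) auto
  also have "\<dots> = (\<integral>\<^sup>+u. \<integral>\<^sup>+v. F (u, v) \<partial>distr M borel V \<partial>distr M borel U)"
    by (rule V.nn_integral_fst[symmetric]) simp
  also have "\<dots> = (\<integral>\<^sup>+\<omega>. \<integral>\<^sup>+v. F (U \<omega>, v) \<partial>distr M borel V \<partial>M)"
    by (rule nn_integral_distr) (auto intro!: V.borel_measurable_nn_integral)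
  also have "\<dots> = (\<integral>\<^sup>+\<omega>. ennreal (1 / sqrt (r k)) *
      ennreal (exp (- (\<Sum>i<k. c i * (Y i \<omega>)\<^sup>2) - p k * (Y k \<omega>)\<^sup>2)) \<partial>M)"
  proof (rule nn_integral_cong)
    fix \<omega>
    let ?q = "\<Sum>i\<le>k. c i * (Y i \<omega>)\<^sup>2"
    have "(\<integral>\<^sup>+v. F (U \<omega>, v) \<partial>distr M borel V) = (\<integral>\<^sup>+\<omega>'. F (U \<omega>, (D k \<omega>', 0)) \<partial>M)"
      by (subst nn_integral_distr) (use V in \<open>auto simp: V_def\<close>)
    also have "\<dots> = (\<integral>\<^sup>+y. ennreal (normal_density 0 s y) * F (U \<omega>, (y, 0)) \<partial>lborel)"
    proof (rule distributed_nn_integral[OF D[OF k], symmetric])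
      show "(\<lambda>y. F (U \<omega>, (y, 0))) \<in> borel_measurable lborel" by (simp add: F_def U_def)
    qed
    also have "\<dots> = (\<integral>\<^sup>+y. ennreal (exp (- ?q)) * (ennreal (normal_density 0 s y) *
        ennreal (exp (- p (Suc k) * (Y k \<omega> + f k * y)\<^sup>2))) \<partial>lborel)"
      by (intro nn_integral_cong) (simp add: F_def U_def mult_ac)
    also have "\<dots> = ennreal (exp (- ?q)) * ennreal (1 / sqrt (r k) * exp (- p (Suc k) / r k * (Y k \<omega>)\<^sup>2))"
      using nn_integral_normal_exp_square[OF s p, of "Suc k" "Y k \<omega>" "f k"] k
      by (subst nn_integral_cmult) (auto simp: r_def)
    also have "\<dots> = ennreal (1 / sqrt (r k)) * ennreal (exp (- ?q) * exp (- p (Suc k) / r k * (Y k \<omega>)\<^sup>2))"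
      using r[OF k] by (simp add: ennreal_mult'[symmetric] mult_ac)
    \<comment> \<open>The weight \<open>c k\<close> is exactly the defect
      \<open>p k - p (Suc k) / r k\<close>, so the last square regains the coefficient
      \<open>p k\<close> required by the induction hypothesis.\<close>
    also have "exp (- ?q) * exp (- p (Suc k) / r k * (Y k \<omega>)\<^sup>2)
        = exp (- (\<Sum>i<k. c i * (Y i \<omega>)\<^sup>2) - p k * (Y k \<omega>)\<^sup>2)"
      by (simp add: c_def exp_add[symmetric] lessThan_Suc_atMost[symmetric] algebra_simps)
    finally show "(\<integral>\<^sup>+v. F (U \<omega>, v) \<partial>distr M borel V) = ennreal (1 / sqrt (r k)) *
      ennreal (exp (- (\<Sum>i<k. c i * (Y i \<omega>)\<^sup>2) - p k * (Y k \<omega>)\<^sup>2))" .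
  qed
  also have "\<dots> = ennreal (1 / sqrt (r k)) *
      (\<integral>\<^sup>+\<omega>. ennreal (exp (- (\<Sum>i<k. c i * (Y i \<omega>)\<^sup>2) - p k * (Y k \<omega>)\<^sup>2)) \<partial>M)"
  proof (rule nn_integral_cmult)
    have [measurable]: "Y i \<in> borel_measurable M" if "i \<le> k" for i
      unfolding Y_def using that k by (intro borel_measurable_sum borel_measurable_times meas) auto
    show "(\<lambda>\<omega>. ennreal (exp (- (\<Sum>i<k. c i * (Y i \<omega>)\<^sup>2) - p k * (Y k \<omega>)\<^sup>2))) \<in> borel_measurable M"
      by measurable
  qed
  also have "\<dots> = ennreal (\<Prod>i<Suc k. 1 / sqrt (r i))"
    using Suc r[OF k] by (simp add: ennreal_mult'[symmetric] mult.commute)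
  finally show ?case .
qed

section \<open>Quadratic functionals of Wiener integrals\<close>

text \<open>On every path the integral is the limit of left Riemann sums, and each of these is a
  finite combination of measurable variables.\<close>

lemma borel_measurable_integral_continuous_process:
  fixes Z :: "real \<Rightarrow> 'a \<Rightarrow> real"
  assumes t: "t > 0" and Z: "\<And>s. s \<in> {0..t} \<Longrightarrow> Z s \<in> borel_measurable M"
    and cont: "\<And>\<omega>. \<omega> \<in> space M \<Longrightarrow> continuous_on {0..t} (\<lambda>s. Z s \<omega>)"
  shows "(\<lambda>\<omega>. integral {0..t} (\<lambda>s. Z s \<omega>)) \<in> borel_measurable M"
proof (rule borel_measurable_LIMSEQ_real)
  show "(\<lambda>n. \<Sum>i<n. t / real n * Z (real i * t / real n) \<omega>) \<longlonglongrightarrow> integral {0..t} (\<lambda>s. Z s \<omega>)"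
    if "\<omega> \<in> space M" for \<omega>
    by (rule grid_lim_sum[OF t grid_lim_point cont[OF that]])
  show "(\<lambda>\<omega>. \<Sum>i<n. t / real n * Z (real i * t / real n) \<omega>) \<in> borel_measurable M" for n
  proof (intro borel_measurable_sum borel_measurable_times borel_measurable_const Z)
    fix i assume "i \<in> {..<n}"
    then show "real i * t / real n \<in> {0..t}" using t by (intro grid_point_mem) auto
  qed
qed

lemma sum_by_parts:
  fixes f w :: "nat \<Rightarrow> real"
  shows "(\<Sum>j<k. f j * (w (Suc j) - w j)) = f k * w k - f 0 * w 0 - (\<Sum>j<k. (f (Suc j) - f j) * w (Suc j))"
  by (induction k) (auto simp: algebra_simps)

text \<open>Summation by parts moves the increments from the rough path \<open>w\<close> to the
  smooth integrand, where difference quotients converge to \<open>\<phi>'\<close>. The bound is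
  uniform in \<open>k\<close> because all partial sums enter the quadratic form.\<close>

lemma grid_sum_wiener_integral:
  fixes w \<phi> \<phi>' :: "real \<Rightarrow> real"
  assumes t: "t > 0"
    and \<phi>: "\<And>s. s \<in> {0..t} \<Longrightarrow> (\<phi> has_real_derivative \<phi>' s) (at s within {0..t})"
    and \<phi>': "continuous_on {0..t} \<phi>'"
    and w: "continuous_on {0..t} w" and w0: "w 0 = 0" and e: "e > 0"
  shows "\<forall>\<^sub>F n in sequentially. \<forall>k\<le>n.
    \<bar>(\<Sum>j<k. \<phi> (real j * t / real n) * (w (real (Suc j) * t / real n) - w (real j * t / real n)))
      - (\<phi> (real k * t / real n) * w (real k * t / real n)
          - integral {0..real k * t / real n} (\<lambda>s. \<phi>' s * w s))\<bar> < e"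
proof -
  have t0: "t \<ge> 0" using t by simp
  have c: "continuous_on {0..t} (\<lambda>s. \<phi>' s * w s)" by (intro continuous_intros \<phi>' w)
  \<comment> \<open>Summation by parts evaluates \<open>w\<close> at right end points, hence the
    shifted grid limit.\<close>
  have "grid_lim t (\<lambda>n i. (\<phi> (real (Suc i) * t / real n) - \<phi> (real i * t / real n)) / (t / real n)
      * w (real (Suc i) * t / real n)) (\<lambda>s. \<phi>' s * w s)"
    by (rule grid_lim_mult[OF t0 grid_lim_difference_quotient[OF t \<phi> \<phi>'] grid_lim_shift[OF t0 w] \<phi>' w])
  from grid_lim_sum_uniform[OF t this c e] eventually_gt_at_top[of 0]
  show ?thesis
  proof eventually_elim
    case (elim n)
    have h: "t / real n \<noteq> 0" using t elim(2) by simp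
    have eq: "t / real n * ((\<phi> (real (Suc i) * t / real n) - \<phi> (real i * t / real n)) / (t / real n)
      * w (real (Suc i) * t / real n)) =
      (\<phi> (real (Suc i) * t / real n) - \<phi> (real i * t / real n)) * w (real (Suc i) * t / real n)" for i
    proof -
      have "h * (x / h * y) = x * y" if "h \<noteq> 0" for h x y :: real using that by simp
      then show ?thesis using h by blast
    qed
    have parts: "(\<Sum>j<k. \<phi> (real j * t / real n) * (w (real (Suc j) * t / real n) - w (real j * t / real n)))
      = \<phi> (real k * t / real n) * w (real k * t / real n) - (\<Sum>j<k. (\<phi> (real (Suc j) * t / real n)
          - \<phi> (real j * t / real n)) * w (real (Suc j) * t / real n))" for k
      using sum_by_parts[of "\<lambda>j. \<phi> (real j * t / real n)" "\<lambda>j. w (real j * t / real n)" k] w0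
      by simp
    have ab: "\<bar>a - s - (a - i)\<bar> < e" if "\<bar>s - i\<bar> < e" for a s i :: real using that by linarith
    show ?case unfolding parts using elim(1) unfolding eq by (blast intro: ab)
  qed
qed

lemma continuous_on_wiener_integral:
  assumes "continuous_on {0..t} \<phi>" "continuous_on {0..t} \<phi>'" "continuous_on {0..t} (\<lambda>s. W s \<omega>)"
  shows "continuous_on {0..t} (\<lambda>s. wiener_integral \<phi> \<phi>' W s \<omega>)"
  unfolding wiener_integral_def
  by (intro continuous_intros assms indefinite_integral_continuous_1 integrable_continuous_real)

text \<open>The discrete functionals \<open>f n\<close> are treated in two ways: their expectations
  converge by the product formula (\<open>lim1\<close>), and they converge on each path to the
  functional \<open>F\<close> (\<open>f_lim\<close>). Domination by 1 identifies the two
  limits.\<close>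

lemma wiener_integral_exp_quadratic:
  fixes M :: "'a measure" and W :: "real \<Rightarrow> 'a \<Rightarrow> real" and \<phi> \<phi>' m P :: "real \<Rightarrow> real"
  assumes W: "wiener_process M I W" and I: "{0..t} \<subseteq> I" and t: "t > 0"
    and \<phi>: "\<And>s. s \<in> {0..t} \<Longrightarrow> (\<phi> has_real_derivative \<phi>' s) (at s within {0..t})"
    and \<phi>': "continuous_on {0..t} \<phi>'"
    and m: "continuous_on {0..t} m" and m_pos: "\<And>s. s \<in> {0..t} \<Longrightarrow> m s > 0"
    and P: "\<And>s. s \<in> {0..t} \<Longrightarrow>
      (P has_real_derivative (2 * (\<phi> s)\<^sup>2 * (P s)\<^sup>2 - m s)) (at s within {0..t})"
    and P_nonneg: "\<And>s. s \<in> {0..t} \<Longrightarrow> P s \<ge> 0"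
  shows "(\<integral>\<omega>. exp (- integral {0..t} (\<lambda>s. m s * (wiener_integral \<phi> \<phi>' W s \<omega>)\<^sup>2)
      - P t * (wiener_integral \<phi> \<phi>' W t \<omega>)\<^sup>2) \<partial>M)
    = exp (- integral {0..t} (\<lambda>s. (\<phi> s)\<^sup>2 * P s))"
proof -
  interpret prob_space M using W by (simp add: wiener_process_def)
  have W_meas: "W s \<in> borel_measurable M" if "s \<in> {0..t}" for s
    using W I that by (auto simp: wiener_process_def)
  have W0: "W 0 \<omega> = 0" and W_cont: "continuous_on {0..t} (\<lambda>s. W s \<omega>)" if "\<omega> \<in> space M" for \<omega>
    using W I that by (auto simp: wiener_process_def intro: continuous_on_subset)
  have t0: "t \<ge> 0" using t by simp
  have \<phi>_cont: "continuous_on {0..t} \<phi>" using \<phi> by (rule DERIV_continuous_on)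
  have P_cont: "continuous_on {0..t} P" using P by (rule DERIV_continuous_on)
  define N where "N = wiener_integral \<phi> \<phi>' W"
  have N_cont: "continuous_on {0..t} (\<lambda>s. N s \<omega>)" if "\<omega> \<in> space M" for \<omega>
    unfolding N_def by (intro continuous_on_wiener_integral \<phi>_cont \<phi>' W_cont that)
  define x where "x = (\<lambda>n i. real i * t / real n)"
  define r where "r = (\<lambda>n i. 1 + 2 * P (x n (Suc i)) * (\<phi> (x n i))\<^sup>2 * (sqrt (t / real n))\<^sup>2)"
  define c where "c = (\<lambda>n i. P (x n i) - P (x n (Suc i)) / r n i)"
  define Y where "Y = (\<lambda>n k \<omega>. \<Sum>j<k. \<phi> (x n j) * (W (x n (Suc j)) \<omega> - W (x n j) \<omega>))"
  define f where "f = (\<lambda>n \<omega>. exp (- (\<Sum>i<n. c n i * (Y n i \<omega>)\<^sup>2) - P t * (Y n n \<omega>)\<^sup>2))"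
  have x_mem: "x n i \<in> {0..t}" if "i \<le> n" for n i
    unfolding x_def using t0 that by (rule grid_point_mem)
  have x_n: "x n n = t" if "n > 0" for n using that by (simp add: x_def)
  have r_eq: "r n i = 1 + 2 * P (x n (Suc i)) * (\<phi> (x n i))\<^sup>2 * (t / real n)" for n i
    using t by (simp add: r_def)
  have r_ge: "r n i \<ge> 1" if "i < n" for n i
    using that t P_nonneg[OF x_mem[of "Suc i" n]] by (simp add: r_eq)
  have Y_meas: "Y n k \<in> borel_measurable M" if "k \<le> n" for n k
    unfolding Y_def using that
    by (intro borel_measurable_sum borel_measurable_times borel_measurable_diff borel_measurable_const
        W_meas x_mem) auto
  have f_meas: "f n \<in> borel_measurable M" for n
    unfolding f_def by (intro borel_measurable_sum borel_measurable_times borel_measurable_diff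
        borel_measurable_const borel_measurable_power measurable_compose[OF _ borel_measurable_exp]
        borel_measurable_uminus Y_meas) auto

  have f_integral: "(\<integral>\<omega>. f n \<omega> \<partial>M) = (\<Prod>i<n. 1 / sqrt (r n i))" if n: "n > 0" for n
  proof -
    have x_less: "x n i < x n j \<longleftrightarrow> i < j" for i j
      using t n by (simp add: x_def divide_less_cancel)
    \<comment> \<open>The grid has \<open>Suc n\<close> points and hence \<open>n\<close>
      increments, which matches the index set \<open>{..<length ts - 1}\<close> in
      \<open>wiener_process\<close>.\<close>
    define ts where "ts = map (x n) [0..<Suc n]"
    have "sorted_wrt (<) ts" unfolding ts_def by (simp only: sorted_wrt_map x_less sorted_wrt_upt)
    moreover have "set ts \<subseteq> I" unfolding ts_def using I x_mem by (auto simp del: upt_Suc)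
    ultimately have "indep_vars (\<lambda>_. borel)
          (\<lambda>i \<omega>. W (ts ! Suc i) \<omega> - W (ts ! i) \<omega>) {..<length ts - 1}"
      using W unfolding wiener_process_def by blast
    also have "?this \<longleftrightarrow> indep_vars (\<lambda>_. borel) (\<lambda>i \<omega>. W (x n (Suc i)) \<omega> - W (x n i) \<omega>) {..<n}"
      by (intro indep_vars_cong) (auto simp: ts_def nth_append simp del: upt_Suc)
    finally have ind: "indep_vars (\<lambda>_. borel) (\<lambda>i \<omega>. W (x n (Suc i)) \<omega> - W (x n i) \<omega>) {..<n}" .
    have "distributed M lborel (\<lambda>\<omega>. W (x n (Suc i)) \<omega> - W (x n i) \<omega>) (normal_density 0 (sqrt (t / real n)))"
      if "i < n" for i
    proof -
      have "x n i \<in> I" "x n (Suc i) \<in> I" using I x_mem[of i n] x_mem[of "Suc i" n] that by auto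
      moreover have "x n i < x n (Suc i)" by (simp add: x_less)
      moreover have "x n (Suc i) - x n i = t / real n" unfolding x_def using n by (rule grid_step)
      ultimately show ?thesis using W unfolding wiener_process_def by metis
    qed
    then have "(\<integral>\<^sup>+\<omega>. ennreal (exp (- (\<Sum>i<n. c n i * (Y n i \<omega>)\<^sup>2) - P (x n n) * (Y n n \<omega>)\<^sup>2)) \<partial>M)
      = ennreal (\<Prod>i<n. 1 / sqrt (r n i))"
      unfolding c_def r_def Y_def
      using t n by (intro nn_integral_exp_quadratic_random_walk[OF ind] P_nonneg x_mem) auto
    then have "(\<integral>\<^sup>+\<omega>. ennreal (f n \<omega>) \<partial>M) = ennreal (\<Prod>i<n. 1 / sqrt (r n i))"
      unfolding f_def x_n[OF n] .
    moreover have "(\<Prod>i<n. 1 / sqrt (r n i)) \<ge> 0"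
      using r_ge by (intro prod_nonneg) (auto intro: order_trans[OF zero_le_one])
    ultimately show ?thesis
      using f_meas by (subst integral_eq_nn_integral) (auto simp: f_def)
  qed

  have q_lim: "grid_lim t (\<lambda>n i. 2 * P (x n (Suc i)) * (\<phi> (x n i))\<^sup>2) (\<lambda>s. 2 * P s * (\<phi> s)\<^sup>2)"
    unfolding x_def
    by (rule grid_lim_mult[OF t0 grid_lim_shift[OF t0, of "\<lambda>s. 2 * P s"] grid_lim_point[of t "\<lambda>s. (\<phi> s)\<^sup>2"]])
      (intro continuous_intros P_cont \<phi>_cont)+
  have q_cont: "continuous_on {0..t} (\<lambda>s. 2 * P s * (\<phi> s)\<^sup>2)" by (intro continuous_intros P_cont \<phi>_cont)

  \<comment> \<open>The product of the \<open>1 / sqrt (r n i)\<close> is the exponential of minus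
    half the sum of their logarithms. Multiplying and dividing by the mesh exhibits that sum as a
    Riemann sum.\<close>
  have "(\<lambda>n. \<Sum>i<n. t / real n * (ln (1 + 2 * P (x n (Suc i)) * (\<phi> (x n i))\<^sup>2 * (t / real n)) / (t / real n)))
      \<longlonglongrightarrow> integral {0..t} (\<lambda>s. 2 * P s * (\<phi> s)\<^sup>2)"
    by (rule grid_lim_sum[OF t grid_lim_ln[OF t q_lim q_cont] q_cont])
      (use P_nonneg[OF x_mem] in \<open>simp add: Suc_le_eq\<close>)
  then have lim0: "(\<lambda>n. exp (- (1 / 2) * (\<Sum>i<n. t / real n * (ln (1 + 2 * P (x n (Suc i)) * (\<phi> (x n i))\<^sup>2 * (t / real n)) / (t / real n)))))
      \<longlonglongrightarrow> exp (- (1 / 2) * integral {0..t} (\<lambda>s. 2 * P s * (\<phi> s)\<^sup>2))"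
    by (intro tendsto_exp tendsto_mult tendsto_const)
  have half: "- (1 / 2) * integral {0..t} (\<lambda>s. 2 * P s * (\<phi> s)\<^sup>2) = - integral {0..t} (\<lambda>s. (\<phi> s)\<^sup>2 * P s)"
  proof -
    have "(\<lambda>s. 2 * P s * (\<phi> s)\<^sup>2) = (\<lambda>s. 2 * ((\<phi> s)\<^sup>2 * P s))" by (auto simp: mult_ac)
    then show ?thesis by simp
  qed
  have ev: "\<forall>\<^sub>F n in sequentially. exp (- (1 / 2) * (\<Sum>i<n. t / real n *
      (ln (1 + 2 * P (x n (Suc i)) * (\<phi> (x n i))\<^sup>2 * (t / real n)) / (t / real n)))) = (\<integral>\<omega>. f n \<omega> \<partial>M)"
    using eventually_gt_at_top[of 0]
  proof eventually_elim
    case (elim n)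
    have "1 / sqrt (r n i) = exp (- (1 / 2) * ln (r n i))" if "i < n" for i
    proof -
      have "r n i > 0" using r_ge[OF that] by simp
      then have "sqrt (r n i) = exp (1 / 2 * ln (r n i))"
        by (simp add: powr_half_sqrt[symmetric] powr_def)
      then show ?thesis by (simp add: exp_minus inverse_eq_divide)
    qed
    then have "(\<integral>\<omega>. f n \<omega> \<partial>M) = exp (\<Sum>i<n. - (1 / 2) * ln (r n i))"
      unfolding f_integral[OF elim] exp_sum[OF finite_lessThan] by (intro prod.cong) auto
    also have "(\<Sum>i<n. - (1 / 2) * ln (r n i)) = - (1 / 2) * (\<Sum>i<n. t / real n *
      (ln (1 + 2 * P (x n (Suc i)) * (\<phi> (x n i))\<^sup>2 * (t / real n)) / (t / real n)))"
      unfolding sum_distrib_left using t elim by (intro sum.cong) (auto simp: r_eq)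
    finally show ?case by simp
  qed
  have lim1: "(\<lambda>n. \<integral>\<omega>. f n \<omega> \<partial>M) \<longlonglongrightarrow> exp (- integral {0..t} (\<lambda>s. (\<phi> s)\<^sup>2 * P s))"
    using Lim_transform_eventually[OF lim0 ev] unfolding half .

  \<comment> \<open>With mesh \<open>h\<close> and
    \<open>q = 2 * P (x n (Suc i)) * (\<phi> (x n i))^2\<close>, the quotient
    \<open>c n i / h\<close> is \<open>(- (P (x n (Suc i)) - P (x n i)) / h + P (x n i) * q) / r n
    i\<close>. It tends to \<open>- P' + 2 * \<phi>^2 * P^2\<close>, which is \<open>m\<close> by
    the Riccati equation.\<close>
  have c_lim: "grid_lim t (\<lambda>n i. c n i / (t / real n)) m"
  proof -
    have r_lim: "grid_lim t (\<lambda>n i. 1 / r n i) (\<lambda>_. 1)"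
    proof (rule grid_lim_squeeze[OF grid_lim_point[of t "\<lambda>_. 1"] grid_lim_mult_mesh[OF t0 q_lim q_cont]])
      have "\<bar>1 / r n i - 1\<bar> \<le> 2 * P (x n (Suc i)) * (\<phi> (x n i))\<^sup>2 * (t / real n)" if "i < n" for n i
      proof -
        have "\<bar>1 / \<rho> - 1\<bar> \<le> \<rho> - 1" if "\<rho> \<ge> 1" for \<rho> :: real
        proof -
          have "1 / \<rho> \<le> 1" using that by simp
          moreover have "(2 - \<rho>) * \<rho> \<le> 1"
            using zero_le_power2[of "\<rho> - 1"] by (simp add: power2_eq_square algebra_simps)
          then have "2 - \<rho> \<le> 1 / \<rho>" using that by (simp add: pos_le_divide_eq)
          ultimately show ?thesis by linarith
        qed
        from this[OF r_ge[OF that]] show ?thesis by (simp add: r_eq)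
      qed
      then show "\<forall>\<^sub>F n in sequentially. \<forall>i<n. \<bar>1 / r n i - 1\<bar> \<le> 2 * P (x n (Suc i)) * (\<phi> (x n i))\<^sup>2 * (t / real n)"
        by (intro always_eventually allI impI)
    qed
    have P'_cont: "continuous_on {0..t} (\<lambda>s. 2 * (\<phi> s)\<^sup>2 * (P s)\<^sup>2 - m s)"
      by (intro continuous_intros P_cont \<phi>_cont m)
    have "grid_lim t (\<lambda>n i. (- ((P (x n (Suc i)) - P (x n i)) / (t / real n))
          + P (x n i) * (2 * P (x n (Suc i)) * (\<phi> (x n i))\<^sup>2)) * (1 / r n i))
        (\<lambda>s. (- (2 * (\<phi> s)\<^sup>2 * (P s)\<^sup>2 - m s) + P s * (2 * P s * (\<phi> s)\<^sup>2)) * 1)"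
    proof (rule grid_lim_mult[OF t0 grid_lim_add[OF grid_lim_minus grid_lim_mult[OF t0 _ q_lim P_cont q_cont]] r_lim])
      show "grid_lim t (\<lambda>n i. (P (x n (Suc i)) - P (x n i)) / (t / real n)) (\<lambda>s. 2 * (\<phi> s)\<^sup>2 * (P s)\<^sup>2 - m s)"
        unfolding x_def using t P P'_cont by (rule grid_lim_difference_quotient)
      show "grid_lim t (\<lambda>n i. P (x n i)) P" unfolding x_def by (rule grid_lim_point)
      show "continuous_on {0..t} (\<lambda>s. - (2 * (\<phi> s)\<^sup>2 * (P s)\<^sup>2 - m s) + P s * (2 * P s * (\<phi> s)\<^sup>2))"
        by (intro continuous_intros P_cont \<phi>_cont m)
    qed simp
    then show ?thesis
    proof (rule grid_lim_cong)
      show "(- (2 * (\<phi> s)\<^sup>2 * (P s)\<^sup>2 - m s) + P s * (2 * P s * (\<phi> s)\<^sup>2)) * 1 = m s" for s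
        by (simp add: power2_eq_square)
      show "t \<ge> 0" by (rule t0)
      have "(- ((P (x n (Suc i)) - P (x n i)) / (t / real n))
          + P (x n i) * (2 * P (x n (Suc i)) * (\<phi> (x n i))\<^sup>2)) * (1 / r n i) = c n i / (t / real n)"
        if "i < n" for n i
      proof -
        have eq: "(- ((b - a) / h) + a * q) * (1 / \<rho>) = (a - b / \<rho>) / h"
          if "\<rho> = 1 + q * h" "\<rho> \<ge> 1" "h > 0" for a b h q \<rho> :: real
        proof -
          have "(a - b / \<rho>) / h = (a * \<rho> - b) / h * (1 / \<rho>)"
            using that(2,3) by (simp add: field_simps)
          also have "a * \<rho> - b = h * (- ((b - a) / h) + a * q)"
            using that(1,3) by (simp add: field_simps)
          finally show ?thesis using that(3) by simp
        qed
        show ?thesis unfolding c_def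
          using t that by (intro eq r_eq r_ge) auto
      qed
      then show "\<forall>\<^sub>F n in sequentially. \<forall>i<n. (- ((P (x n (Suc i)) - P (x n i)) / (t / real n))
          + P (x n i) * (2 * P (x n (Suc i)) * (\<phi> (x n i))\<^sup>2)) * (1 / r n i) = c n i / (t / real n)"
        by (intro always_eventually allI impI)
    qed
  qed

  define F where "F = (\<lambda>\<omega>. exp (- integral {0..t} (\<lambda>s. m s * (N s \<omega>)\<^sup>2) - P t * (N t \<omega>)\<^sup>2))"
  have f_lim: "(\<lambda>n. f n \<omega>) \<longlonglongrightarrow> F \<omega>" if \<omega>: "\<omega> \<in> space M" for \<omega>
  proof -
    have Y_unif: "\<forall>\<^sub>F n in sequentially. \<forall>k\<le>n. \<bar>Y n k \<omega> - N (x n k) \<omega>\<bar> < e" if "e > 0" for e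
      using grid_sum_wiener_integral[OF t \<phi> \<phi>' W_cont[OF \<omega>] W0[OF \<omega>] that]
      by (simp add: Y_def N_def wiener_integral_def x_def)
    have Y_lim: "grid_lim t (\<lambda>n i. Y n i \<omega>) (\<lambda>s. N s \<omega>)"
      unfolding grid_lim_def
    proof (intro allI impI)
      fix e :: real assume "e > 0"
      from Y_unif[OF this] show "\<forall>\<^sub>F n in sequentially. \<forall>i<n. \<bar>Y n i \<omega> - N (real i * t / real n) \<omega>\<bar> < e"
        by eventually_elim (simp add: x_def)
    qed
    have Y_end: "(\<lambda>n. Y n n \<omega>) \<longlonglongrightarrow> N t \<omega>"
    proof (rule tendstoI)
      fix e :: real assume "e > 0"
      from Y_unif[OF this] eventually_gt_at_top[of 0]
      show "\<forall>\<^sub>F n in sequentially. dist (Y n n \<omega>) (N t \<omega>) < e"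
      proof eventually_elim
        case (elim n)
        then show ?case using x_n[of n] by (auto simp: dist_real_def dest!: spec[of _ n])
      qed
    qed
    note Nc = N_cont[OF \<omega>]
    have "(\<lambda>n. \<Sum>i<n. t / real n * (c n i / (t / real n) * (Y n i \<omega> * Y n i \<omega>)))
        \<longlonglongrightarrow> integral {0..t} (\<lambda>s. m s * (N s \<omega> * N s \<omega>))"
      by (rule grid_lim_sum[OF t grid_lim_mult[OF t0 c_lim grid_lim_mult[OF t0 Y_lim Y_lim]]])
        (intro continuous_intros Nc m)+
    moreover have "(\<Sum>i<n. t / real n * (c n i / (t / real n) * (Y n i \<omega> * Y n i \<omega>)))
        = (\<Sum>i<n. c n i * (Y n i \<omega>)\<^sup>2)" for n
      using t by (intro sum.cong) (auto simp: power2_eq_square)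
    ultimately have "(\<lambda>n. \<Sum>i<n. c n i * (Y n i \<omega>)\<^sup>2) \<longlonglongrightarrow> integral {0..t} (\<lambda>s. m s * (N s \<omega>)\<^sup>2)"
      by (simp add: power2_eq_square)
    then show ?thesis unfolding f_def F_def by (intro tendsto_intros Y_end)
  qed
  have F_meas: "F \<in> borel_measurable M"
    using f_lim f_meas by (rule borel_measurable_LIMSEQ_real)

  \<comment> \<open>The continuous positive \<open>m\<close> has a positive minimum on the compact
    interval. Uniform convergence then makes all weights nonnegative at once for large
    \<open>n\<close>, which bounds \<open>f n\<close> by 1.\<close>
  have "\<exists>z\<in>{0..t}. \<forall>s\<in>{0..t}. m z \<le> m s"
    using t by (intro continuous_attains_inf m) auto
  then obtain z where z: "z \<in> {0..t}" "\<And>s. s \<in> {0..t} \<Longrightarrow> m z \<le> m s" by blast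
  have "\<forall>\<^sub>F n in sequentially. \<forall>i<n. c n i \<ge> 0"
    using grid_limD[OF c_lim m_pos[OF z(1)]]
  proof eventually_elim
    case (elim n)
    show ?case
    proof (intro allI impI)
      fix i assume i: "i < n"
      then have "\<bar>c n i / (t / real n) - m (x n i)\<bar> < m z" using elim by (simp add: x_def)
      moreover have "m z \<le> m (x n i)" using i by (intro z x_mem) auto
      ultimately have "c n i / (t / real n) > 0" by linarith
      then show "c n i \<ge> 0" using t i by (simp add: zero_less_divide_iff zero_less_mult_iff)
    qed
  qed
  then obtain n0 where c_nonneg: "\<And>n i. n \<ge> n0 \<Longrightarrow> i < n \<Longrightarrow> c n i \<ge> 0"
    unfolding eventually_sequentially by blast
  \<comment> \<open>Dominated convergence asks for the bound at every index, so the sequence starts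
    at \<open>n0\<close>.\<close>
  have "(\<lambda>n. \<integral>\<omega>. f (n + n0) \<omega> \<partial>M) \<longlonglongrightarrow> (\<integral>\<omega>. F \<omega> \<partial>M)"
  proof (rule integral_dominated_convergence[where w = "\<lambda>_. 1"])
    show "AE \<omega> in M. (\<lambda>n. f (n + n0) \<omega>) \<longlonglongrightarrow> F \<omega>"
      using f_lim by (intro AE_I2 LIMSEQ_ignore_initial_segment) auto
    show "AE \<omega> in M. norm (f (n + n0) \<omega>) \<le> 1" for n
    proof (rule AE_I2)
      fix \<omega>
      have "(\<Sum>i<n + n0. c (n + n0) i * (Y (n + n0) i \<omega>)\<^sup>2) \<ge> 0"
        by (intro sum_nonneg mult_nonneg_nonneg c_nonneg) auto
      moreover have "P t * (Y (n + n0) (n + n0) \<omega>)\<^sup>2 \<ge> 0"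
        using P_nonneg[of t] t by simp
      ultimately show "norm (f (n + n0) \<omega>) \<le> 1" unfolding f_def by simp
    qed
  qed (use f_meas F_meas in auto)
  then have "(\<integral>\<omega>. F \<omega> \<partial>M) = exp (- integral {0..t} (\<lambda>s. (\<phi> s)\<^sup>2 * P s))"
    using LIMSEQ_ignore_initial_segment[OF lim1] by (rule LIMSEQ_unique)
  then show ?thesis by (simp add: F_def N_def)
qed

section \<open>Variation of constants and the explicit Riccati solution\<close>

text \<open>The function \<open>A\<close> is the integrating factor. Since
  \<open>(\<sigma>' u - a u * \<sigma> u) / A u\<close> is the derivative of
  \<open>\<sigma> / A\<close>, the bracket is the Wiener integral of \<open>\<sigma> / A\<close> in
  its integrated-by-parts form.\<close>

lemma variation_of_constants:
  fixes a A \<sigma> \<sigma>' w X :: "real \<Rightarrow> real"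
  assumes A: "\<And>s. s \<in> {0..t} \<Longrightarrow> (A has_real_derivative a s * A s) (at s within {0..t})"
    and A_nz: "\<And>s. A s \<noteq> 0"
    and a: "continuous_on {0..t} a" and \<sigma>: "continuous_on {0..t} \<sigma>" and \<sigma>': "continuous_on {0..t} \<sigma>'"
    and w: "continuous_on {0..t} w" and X: "continuous_on {0..t} X"
    and eq: "\<And>s. s \<in> {0..t} \<Longrightarrow>
      X s = integral {0..s} (\<lambda>u. a u * X u) + (\<sigma> s * w s - integral {0..s} (\<lambda>u. \<sigma>' u * w u))"
    and s: "s \<in> {0..t}"
  shows "X s = A s * (\<sigma> s / A s * w s - integral {0..s} (\<lambda>u. (\<sigma>' u - a u * \<sigma> u) / A u * w u))"
proof -
  \<comment> \<open>The path \<open>w\<close> is merely continuous, so \<open>\<sigma> * w\<close>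
    is split off: the remainder \<open>Z\<close> is differentiable although \<open>X\<close> need
    not be.\<close>
  define Z where "Z = (\<lambda>s. integral {0..s} (\<lambda>u. a u * X u) - integral {0..s} (\<lambda>u. \<sigma>' u * w u))"
  have Z_eq: "Z s = X s - \<sigma> s * w s" if "s \<in> {0..t}" for s using eq[OF that] by (simp add: Z_def)
  have A_cont: "continuous_on {0..t} A" using A by (rule DERIV_continuous_on)
  \<comment> \<open>From \<open>Z' = a * Z + (a * \<sigma> - \<sigma>') * w\<close> the derivative
    of \<open>Z / A\<close> is \<open>(a * \<sigma> - \<sigma>') / A * w\<close>, which the integral
    term cancels. Hence \<open>H\<close> is constant, with value 0 at time 0.\<close>
  define H where "H = (\<lambda>s. Z s / A s + integral {0..s} (\<lambda>u. (\<sigma>' u - a u * \<sigma> u) / A u * w u))"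
  have "(H has_real_derivative 0) (at s within {0..t})" if s: "s \<in> {0..t}" for s
  proof -
    have Z: "(Z has_real_derivative (a s * X s - \<sigma>' s * w s)) (at s within {0..t})"
      unfolding Z_def
      by (intro DERIV_diff integral_has_real_derivative s continuous_intros a X \<sigma>' w)
    have J: "((\<lambda>s. integral {0..s} (\<lambda>u. (\<sigma>' u - a u * \<sigma> u) / A u * w u)) has_real_derivative
        (\<sigma>' s - a s * \<sigma> s) / A s * w s) (at s within {0..t})"
      using A_nz by (intro integral_has_real_derivative s continuous_intros a \<sigma> \<sigma>' w A_cont) auto
    have "((\<lambda>s. Z s / A s) has_real_derivative
        ((a s * X s - \<sigma>' s * w s) * A s - Z s * (a s * A s)) / (A s * A s)) (at s within {0..t})"
      by (rule DERIV_divide[OF Z A[OF s] A_nz])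
    from DERIV_add[OF this J] have "(H has_real_derivative
        ((a s * X s - \<sigma>' s * w s) * A s - Z s * (a s * A s)) / (A s * A s)
          + (\<sigma>' s - a s * \<sigma> s) / A s * w s) (at s within {0..t})" unfolding H_def .
    also have "((a s * X s - \<sigma>' s * w s) * A s - Z s * (a s * A s)) / (A s * A s)
          + (\<sigma>' s - a s * \<sigma> s) / A s * w s = 0"
      unfolding Z_eq[OF s] using A_nz[of s] by (simp add: field_simps)
    finally show ?thesis .
  qed
  then obtain c where c: "\<And>s. s \<in> {0..t} \<Longrightarrow> H s = c"
    using has_field_derivative_zero_constant[of "{0..t}" H] by auto
  have "H 0 = 0" by (simp add: H_def Z_def)
  then have "H s = 0" using c[of 0] c[OF s] s by auto
  then have "Z s / A s = - integral {0..s} (\<lambda>u. (\<sigma>' u - a u * \<sigma> u) / A u * w u)"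
    by (simp add: H_def)
  then have "integral {0..s} (\<lambda>u. (\<sigma>' u - a u * \<sigma> u) / A u * w u) = - (Z s / A s)" by simp
  then show ?thesis using Z_eq[OF s] A_nz[of s] by (simp only:) (simp add: field_simps)
qed

text \<open>In exponentials the coefficients are \<open>(1 + k) / 2\<close> and
  \<open>(1 - k) / 2\<close>, both positive.\<close>

lemma cosh_add_mult_sinh_pos:
  fixes k x :: real
  assumes "\<bar>k\<bar> < 1"
  shows "cosh x + k * sinh x > 0"
proof -
  have "cosh x + k * sinh x = ((1 + k) * exp x + (1 - k) * exp (- x)) / 2"
    by (simp add: cosh_field_def sinh_field_def field_simps)
  moreover have "(1 + k) * exp x + (1 - k) * exp (- x) > 0"
    using assms by (intro add_pos_pos[of "(1 + k) * exp x"] mult_pos_pos exp_gt_zero) linarith+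
  ultimately show ?thesis by simp
qed

text \<open>For \<open>d > 0\<close> the number \<open>sinh (d * x)\<close> has the sign of
  \<open>x\<close>. The product form treats both signs of \<open>g\<close> together.\<close>

lemma mult_sinh_nonneg:
  fixes g x d :: real
  assumes "g * x \<ge> 0" "d > 0"
  shows "g * sinh (d * x) \<ge> 0"
proof (cases "x \<ge> 0")
  case True
  then show ?thesis using assms by (cases "x = 0") (auto simp: zero_le_mult_iff)
next
  case False
  then have "g \<le> 0" "d * x \<le> 0" using assms by (auto simp: zero_le_mult_iff mult_le_0_iff)
  then show ?thesis by (intro mult_nonpos_nonpos) auto
qed

text \<open>The substitution \<open>w = \<kappa> / 4 + v / (2 * u)\<close>, where \<open>v\<close> is the derivative of
  \<open>u\<close> in the clock \<open>L\<close>, linearises the Riccati equation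
  \<open>w' = 2 * w\<^sup>2 - \<kappa> * w - \<mu> / 4\<close> run in that clock with terminal value \<open>\<nu> * G t\<close>.\<close>
locale riccati =
  fixes K \<alpha> \<mu> \<nu> t :: real and \<sigma> G L :: "real \<Rightarrow> real"
  assumes \<mu>: "\<mu> > 0" and \<nu>: "\<nu> \<ge> 0" and t: "t > 0"
    and G: "\<And>s. s \<in> {0..t} \<Longrightarrow> (G has_real_derivative K * (\<sigma> s)\<^sup>2) (at s within {0..t})"
    and L: "\<And>s. s \<in> {0..t} \<Longrightarrow> (L has_real_derivative (\<sigma> s)\<^sup>2 / G s) (at s within {0..t})"
    and G_sign: "\<And>s r. s \<in> {0..t} \<Longrightarrow> r \<in> {0..t} \<Longrightarrow> G s * G r > 0"
begin

definition "\<kappa> = \<alpha> - K"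
definition "D = sqrt (2 * \<mu> + \<kappa>\<^sup>2)"
definition "l s = L t - L s"
text \<open>As a function of the remaining clock time \<open>l\<close>, this solves a linear
  equation with frequency \<open>D / 2\<close>, normalised by \<open>u t = 1\<close>. When
  \<open>L 0 = 0\<close>, its value at 0 is the expression under the square root in the final
  formula.\<close>

definition "u s = cosh (D / 2 * l s) - (\<kappa> - 4 * \<nu> * G t) / D * sinh (D / 2 * l s)"
definition "v s = D / 2 * sinh (D / 2 * l s) - (\<kappa> - 4 * \<nu> * G t) / 2 * cosh (D / 2 * l s)"
definition "w s = \<kappa> / 4 + v s / (2 * u s)"
definition "A s = exp (\<alpha> / 2 * L s)"
definition "P s = w s * (A s)\<^sup>2 / G s"

section \<open>Positivity of the explicit Riccati solution\<close>

lemma G_nz: "s \<in> {0..t} \<Longrightarrow> G s \<noteq> 0"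
  using G_sign[of s s] by auto

lemma D_pos: "D > 0" and D_sq: "D\<^sup>2 = 2 * \<mu> + \<kappa>\<^sup>2" and \<kappa>_less: "\<bar>\<kappa> / D\<bar> < 1"
proof -
  show D: "D > 0" using \<mu> by (simp add: D_def add_pos_nonneg)
  show "D\<^sup>2 = 2 * \<mu> + \<kappa>\<^sup>2" using \<mu> by (simp add: D_def)
  have "\<bar>\<kappa>\<bar> < D" unfolding D_def using \<mu> by (intro real_less_rsqrt) simp
  then show "\<bar>\<kappa> / D\<bar> < 1" using D by (simp add: abs_divide)
qed

text \<open>The clock \<open>L\<close> has derivative \<open>\<sigma>^2 / G\<close>, whose sign is
  the constant sign of \<open>G\<close>. So \<open>l\<close> vanishes or has that sign as well, be
  it positive or negative.\<close>

lemma G_mult_l_nonneg: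
  assumes s: "s \<in> {0..t}" and r: "r \<in> {0..t}"
  shows "G r * l s \<ge> 0"
proof -
  have "\<exists>z\<in>{s..t}. L t - L s = (\<sigma> z)\<^sup>2 / G z * (t - s)"
  proof (rule mvt_very_simple)
    show "s \<le> t" using s by simp
    fix z assume "s \<le> z" "z \<le> t"
    then have "(L has_real_derivative (\<sigma> z)\<^sup>2 / G z) (at z within {s..t})"
      using s by (intro DERIV_subset[OF L]) auto
    then show "(L has_derivative (*) ((\<sigma> z)\<^sup>2 / G z)) (at z within {s..t})"
      by (simp add: has_field_derivative_def)
  qed
  then obtain z where z: "z \<in> {s..t}" "l s = (\<sigma> z)\<^sup>2 / G z * (t - s)" by (auto simp: l_def)
  have "G r * G z > 0" using z s r by (intro G_sign) auto
  then have "G r / G z \<ge> 0" by (auto simp: zero_less_mult_iff zero_le_divide_iff)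
  then have "G r / G z * ((\<sigma> z)\<^sup>2 * (t - s)) \<ge> 0" using s by (intro mult_nonneg_nonneg) auto
  then show ?thesis by (simp add: z(2) mult_ac)
qed

lemma G_mult_sinh_nonneg:
  assumes "s \<in> {0..t}" "r \<in> {0..t}"
  shows "G r * sinh (D / 2 * l s) \<ge> 0"
  using mult_sinh_nonneg[OF G_mult_l_nonneg[OF assms], of "D / 2"] D_pos by simp

text \<open>The part of \<open>u\<close> without \<open>\<nu>\<close> is positive because
  \<open>\<bar>\<kappa> / D\<bar> < 1\<close>, and the part with \<open>\<nu>\<close> is a
  nonnegative multiple of \<open>G t * sinh (D / 2 * l s)\<close>.\<close>

lemma u_pos:
  assumes s: "s \<in> {0..t}"
  shows "u s > 0"
proof -
  have "u s = cosh (D / 2 * l s) + (- \<kappa> / D) * sinh (D / 2 * l s)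
      + 4 * \<nu> / D * (G t * sinh (D / 2 * l s))"
    by (simp add: u_def diff_divide_distrib algebra_simps)
  moreover have "cosh (D / 2 * l s) + (- \<kappa> / D) * sinh (D / 2 * l s) > 0"
    using \<kappa>_less by (intro cosh_add_mult_sinh_pos) simp
  moreover have "4 * \<nu> / D * (G t * sinh (D / 2 * l s)) \<ge> 0"
    using \<nu> D_pos G_mult_sinh_nonneg[OF s, of t] t
    by (intro mult_nonneg_nonneg[of "4 * \<nu> / D"]) auto
  ultimately show ?thesis by linarith
qed

lemma P_nonneg:
  assumes s: "s \<in> {0..t}"
  shows "P s \<ge> 0"
proof -
  let ?S = "sinh (D / 2 * l s)" and ?C = "cosh (D / 2 * l s)"
  have "4 * u s * w s = \<kappa> * u s + 2 * v s"
    using u_pos[OF s] by (simp add: w_def field_simps)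
  \<comment> \<open>Collecting terms produces \<open>D^2 - \<kappa>^2 = 2 * \<mu>\<close>. After
    multiplication by \<open>G s\<close>, which also removes the ambiguity of its sign, both
    summands are visibly nonnegative.\<close>
  also have "\<dots> = 4 * \<nu> * G t * (?C + \<kappa> / D * ?S) + (D\<^sup>2 - \<kappa>\<^sup>2) / D * ?S"
    using D_pos by (simp add: u_def v_def field_simps power2_eq_square)
  also have "\<dots> = 4 * \<nu> * G t * (?C + \<kappa> / D * ?S) + 2 * \<mu> / D * ?S" by (simp add: D_sq)
  finally have "G s * (4 * u s * w s)
      = 4 * \<nu> * (G s * G t) * (?C + \<kappa> / D * ?S) + 2 * \<mu> / D * (G s * ?S)"
    by (simp add: algebra_simps)
  also have "\<dots> \<ge> 0"
    using \<mu> \<nu> D_pos t less_imp_le[OF cosh_add_mult_sinh_pos[OF \<kappa>_less, of "D / 2 * l s"]]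
      less_imp_le[OF G_sign[OF s, of t]] G_mult_sinh_nonneg[OF s s]
    by (intro add_nonneg_nonneg[of "4 * \<nu> * (G s * G t) * (?C + \<kappa> / D * ?S)"]
        mult_nonneg_nonneg[of "4 * \<nu> * (G s * G t)"]
        mult_nonneg_nonneg[of "2 * \<mu> / D"] mult_nonneg_nonneg[of "4 * \<nu>"]) auto
  finally have "4 * u s * (G s * w s) \<ge> 0" by (simp add: mult_ac)
  then have "G s * w s \<ge> 0" using u_pos[OF s] by (simp add: zero_le_mult_iff)
  then have "G s * w s * (A s)\<^sup>2 / (G s)\<^sup>2 \<ge> 0" by simp
  also have "G s * w s * (A s)\<^sup>2 / (G s)\<^sup>2 = P s"
    using G_nz[OF s] by (simp add: P_def power2_eq_square)
  finally show ?thesis .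
qed

section \<open>Differential equations for the explicit solution\<close>

lemma has_derivative_l:
  "s \<in> {0..t} \<Longrightarrow> (l has_real_derivative - ((\<sigma> s)\<^sup>2 / G s)) (at s within {0..t})"
  unfolding l_def by (auto intro!: derivative_eq_intros L)

lemma has_derivative_u:
  assumes "s \<in> {0..t}"
  shows "(u has_real_derivative - ((\<sigma> s)\<^sup>2 / G s) * v s) (at s within {0..t})"
  unfolding u_def
  by (rule derivative_eq_intros has_derivative_l assms refl)+
    (use D_pos G_nz[OF assms] in \<open>simp add: v_def field_simps\<close>)

lemma has_derivative_v:
  assumes "s \<in> {0..t}"
  shows "(v has_real_derivative - ((\<sigma> s)\<^sup>2 / G s) * (D\<^sup>2 / 4 * u s)) (at s within {0..t})"
  unfolding v_def
  by (rule derivative_eq_intros has_derivative_l assms refl)+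
    (use D_pos G_nz[OF assms] in \<open>simp add: u_def power2_eq_square field_simps\<close>)

lemma has_derivative_w:
  assumes s: "s \<in> {0..t}"
  shows "(w has_real_derivative (\<sigma> s)\<^sup>2 / G s * (2 * (w s)\<^sup>2 - \<kappa> * w s - \<mu> / 4)) (at s within {0..t})"
proof -
  define y where "y = v s / (2 * u s)"
  define g where "g = (\<sigma> s)\<^sup>2 / G s"
  have u: "u s \<noteq> 0" using u_pos[OF s] by simp
  have v: "v s = 2 * u s * y" using u by (simp add: y_def)
  have "((\<lambda>s. v s / (2 * u s)) has_real_derivative
      ((- g * (D\<^sup>2 / 4 * u s)) * (2 * u s) - v s * (2 * (- g * v s))) / (2 * u s * (2 * u s)))
      (at s within {0..t})"
    unfolding g_def
    by (rule DERIV_divide[OF has_derivative_v[OF s] DERIV_cmult[OF has_derivative_u[OF s]]]) (use u in simp)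
  then have "(w has_real_derivative 0 +
      ((- g * (D\<^sup>2 / 4 * u s)) * (2 * u s) - v s * (2 * (- g * v s))) / (2 * u s * (2 * u s)))
      (at s within {0..t})"
    unfolding w_def by (intro DERIV_add DERIV_const)
  also have "0 + ((- g * (D\<^sup>2 / 4 * u s)) * (2 * u s) - v s * (2 * (- g * v s))) / (2 * u s * (2 * u s))
      = g * (2 * y\<^sup>2 - D\<^sup>2 / 8)"
    unfolding v using u by (simp add: field_simps power2_eq_square)
  \<comment> \<open>Here \<open>y = w s - \<kappa> / 4\<close>. The shift creates the linear term,
    and the constant \<open>\<kappa>^2 / 8\<close> cancels against the one in
    \<open>D^2 / 8\<close>.\<close>
  also have "2 * y\<^sup>2 - D\<^sup>2 / 8 = 2 * (w s)\<^sup>2 - \<kappa> * w s - \<mu> / 4"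
    unfolding w_def y_def[symmetric] D_sq by (simp add: field_simps power2_eq_square)
  finally show ?thesis unfolding g_def .
qed

lemma has_derivative_A:
  assumes "s \<in> {0..t}"
  shows "(A has_real_derivative \<alpha> * ((\<sigma> s)\<^sup>2 / (2 * G s)) * A s) (at s within {0..t})"
  unfolding A_def
  by (rule derivative_eq_intros L assms refl)+ (simp add: mult_ac)

text \<open>Rescaling \<open>w\<close> by \<open>A^2 / G\<close> removes the linear term of its
  Riccati equation: differentiating \<open>A^2\<close> contributes \<open>\<alpha>\<close>,
  differentiating \<open>1 / G\<close> contributes \<open>- K\<close>, and their sum cancels
  \<open>- \<kappa>\<close>. What remains is the Riccati equation for the integrand
  \<open>\<sigma> / A\<close>.\<close>

lemma has_derivative_P:
  assumes s: "s \<in> {0..t}"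
  shows "(P has_real_derivative
    2 * (\<sigma> s / A s)\<^sup>2 * (P s)\<^sup>2 - \<mu> * ((\<sigma> s)\<^sup>2 / (4 * (G s)\<^sup>2)) * (A s)\<^sup>2) (at s within {0..t})"
proof -
  have Gs: "G s \<noteq> 0" using G_nz[OF s] .
  have As: "A s \<noteq> 0" by (simp add: A_def)
  have "((\<lambda>s. w s * (A s)\<^sup>2 / G s) has_real_derivative
     (((\<sigma> s)\<^sup>2 / G s * (2 * (w s)\<^sup>2 - \<kappa> * w s - \<mu> / 4) * (A s)\<^sup>2
        + 2 * A s * (\<alpha> * ((\<sigma> s)\<^sup>2 / (2 * G s)) * A s) * w s) * G s
      - w s * (A s)\<^sup>2 * (K * (\<sigma> s)\<^sup>2)) / (G s * G s)) (at s within {0..t})"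
    by (rule derivative_eq_intros has_derivative_w has_derivative_A G s Gs refl)+
      (simp add: algebra_simps power2_eq_square)
  also have "(((\<sigma> s)\<^sup>2 / G s * (2 * (w s)\<^sup>2 - \<kappa> * w s - \<mu> / 4) * (A s)\<^sup>2
        + 2 * A s * (\<alpha> * ((\<sigma> s)\<^sup>2 / (2 * G s)) * A s) * w s) * G s
      - w s * (A s)\<^sup>2 * (K * (\<sigma> s)\<^sup>2)) / (G s * G s)
    = (\<sigma> s)\<^sup>2 * (A s)\<^sup>2 * (2 * (w s)\<^sup>2 - \<mu> / 4) / (G s)\<^sup>2"
    using Gs by (simp add: \<kappa>_def field_simps power2_eq_square)
  also have "\<dots> = 2 * (\<sigma> s / A s)\<^sup>2 * (P s)\<^sup>2 - \<mu> * ((\<sigma> s)\<^sup>2 / (4 * (G s)\<^sup>2)) * (A s)\<^sup>2"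
    unfolding P_def using Gs As by (simp add: field_simps power2_eq_square)
  finally show ?thesis unfolding P_def .
qed

text \<open>Since \<open>l t = 0\<close>, one has \<open>w t = \<nu> * G t\<close>. For
  \<open>X = A * N\<close> the terminal term \<open>P t * N^2\<close> is therefore
  \<open>\<nu> * X^2\<close> at time \<open>t\<close>.\<close>

lemma P_terminal: "P t = \<nu> * (A t)\<^sup>2"
  using G_nz[of t] t by (simp add: P_def w_def u_def v_def l_def field_simps)

text \<open>The integrand is \<open>\<sigma>^2 / G * w\<close>. Since
  \<open>u' = - \<sigma>^2 / G * v\<close>, the summand \<open>v / (2 * u)\<close> of
  \<open>w\<close> integrates to \<open>- ln u / 2\<close> and the constant
  \<open>\<kappa> / 4\<close> to \<open>- \<kappa> / 4 * l\<close>.\<close>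

lemma exp_integral_P:
  "exp (- integral {0..t} (\<lambda>s. (\<sigma> s / A s)\<^sup>2 * P s)) = exp (- \<kappa> / 4 * l 0) / sqrt (u 0)"
proof -
  define Q where "Q = (\<lambda>s. - (\<kappa> / 4 * l s + ln (u s) / 2))"
  have "(Q has_real_derivative (\<sigma> s / A s)\<^sup>2 * P s) (at s within {0..t})" if s: "s \<in> {0..t}" for s
  proof -
    have A: "A s \<noteq> 0" by (simp add: A_def)
    have "((\<lambda>s. ln (u s)) has_real_derivative 1 / u s * (- ((\<sigma> s)\<^sup>2 / G s) * v s)) (at s within {0..t})"
      using DERIV_ln_divide[OF u_pos[OF s]] has_derivative_u[OF s] by (rule DERIV_chain2)
    from DERIV_minus[OF DERIV_add[OF DERIV_cmult[OF has_derivative_l[OF s], of "\<kappa> / 4"] DERIV_cdivide[OF this, of 2]]]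
    have "(Q has_real_derivative - (\<kappa> / 4 * - ((\<sigma> s)\<^sup>2 / G s)
        + 1 / u s * (- ((\<sigma> s)\<^sup>2 / G s) * v s) / 2)) (at s within {0..t})"
      unfolding Q_def .
    also have "- (\<kappa> / 4 * - ((\<sigma> s)\<^sup>2 / G s) + 1 / u s * (- ((\<sigma> s)\<^sup>2 / G s) * v s) / 2)
        = (\<sigma> s)\<^sup>2 / G s * w s"
      by (simp add: w_def algebra_simps)
    also have "\<dots> = (\<sigma> s / A s)\<^sup>2 * P s"
      using A by (simp add: P_def power_divide)
    finally show ?thesis .
  qed
  then have "((\<lambda>s. (\<sigma> s / A s)\<^sup>2 * P s) has_integral (Q t - Q 0)) {0..t}"
    using t by (intro fundamental_theorem_of_calculus)
      (auto simp flip: has_real_derivative_iff_has_vector_derivative)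
  then have "integral {0..t} (\<lambda>s. (\<sigma> s / A s)\<^sup>2 * P s) = Q t - Q 0" by (rule integral_unique)
  moreover have "Q t = 0" by (simp add: Q_def l_def u_def)
  moreover have "sqrt (u 0) = exp (ln (u 0) / 2)"
    using u_pos[of 0] t by (simp add: powr_half_sqrt[symmetric] powr_def)
  ultimately have "integral {0..t} (\<lambda>s. (\<sigma> s / A s)\<^sup>2 * P s) = - Q 0"
    and "sqrt (u 0) = exp (ln (u 0) / 2)" by simp_all
  moreover have "exp (- (- Q 0)) = exp (- \<kappa> / 4 * l 0) / exp (ln (u 0) / 2)"
    unfolding exp_diff[symmetric] by (simp add: Q_def)
  ultimately show ?thesis by simp
qed

end

section \<open>The Laplace transform\<close>

theorem mainTheorem4:
  fixes M :: "'a measure"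
    and T :: ereal
    and \<sigma> \<sigma>' :: "real \<Rightarrow> real"
    and K C :: real
    and W :: "real \<Rightarrow> 'a \<Rightarrow> real"
    and X :: "real \<Rightarrow> real \<Rightarrow> 'a \<Rightarrow> real"
  defines "I \<equiv> time_set T"
    and "b \<equiv> (\<lambda>t. (\<sigma> t)^2 / (2 * (K * sigma_int \<sigma> t + C)))"
  assumes T_pos: "T > 0"
    and sigma_pos: "\<forall>t\<in>I. \<sigma> t > 0"
    and sigma_deriv: "\<forall>t\<in>I. (\<sigma> has_real_derivative \<sigma>' t) (at t within I)"
    and sigma'_cont: "continuous_on I \<sigma>'"
    and denom_nz: "\<forall>t\<in>I. K * sigma_int \<sigma> t + C \<noteq> 0"
    and W: "wiener_process M I W"
    and X: "\<forall>\<alpha>. linear_sde_solution M I (\<lambda>t. \<alpha> * b t) \<sigma> \<sigma>' W (X \<alpha>)"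
  shows "\<forall>\<alpha>::real. \<forall>\<mu>::real. \<forall>\<nu>::real. \<forall>t\<in>I. \<mu> > 0 \<longrightarrow> \<nu> \<ge> 0 \<longrightarrow>
    (let D = sqrt (2 * \<mu> + (\<alpha> - K)^2); L = ln (B_KC K C \<sigma> t) in
      (\<integral>\<omega>. exp (- \<mu> * integral {0..t} (\<lambda>s. (b s)^2 / (\<sigma> s)^2 * (X \<alpha> s \<omega>)^2)
                   - \<nu> * (X \<alpha> t \<omega>)^2) \<partial>M)
      = (B_KC K C \<sigma> t) powr ((K - \<alpha>) / 4)
        / sqrt (cosh (D / 2 * L)
                - (\<alpha> - K - 4 * \<nu> * (K * sigma_int \<sigma> t + C)) / D * sinh (D / 2 * L)))"
proof (intro allI ballI impI)
  fix \<alpha> \<mu> \<nu> t :: real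
  assume tI: "t \<in> I" and \<mu>: "\<mu> > 0" and \<nu>: "\<nu> \<ge> 0"
  interpret prob_space M using W by (simp add: wiener_process_def)
  note Xa = X[THEN spec, of \<alpha>, unfolded linear_sde_solution_def]
  have I_t: "{0..t} \<subseteq> I"
  proof
    fix s assume s: "s \<in> {0..t}"
    then have "ereal s \<le> ereal t" by simp
    then show "s \<in> I" using s tI order_le_less_trans[of "ereal s" "ereal t" T] by (auto simp: I_def time_set_def)
  qed
  have t0: "t \<ge> 0" using tI by (simp add: I_def time_set_def)
  define S where "S = sigma_int \<sigma>"
  define G where "G = (\<lambda>s. K * S s + C)"
  define L where "L = (\<lambda>s. ln (B_KC K C \<sigma> s))"
  have S0: "S 0 = 0" by (simp add: S_def sigma_int_def)
  have B0: "B_KC K C \<sigma> 0 = 1" using S0 by (simp add: B_KC_def S_def)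
  have L0: "L 0 = 0" using B0 by (simp add: L_def)
  show "let D = sqrt (2 * \<mu> + (\<alpha> - K)^2); L = ln (B_KC K C \<sigma> t) in
      (\<integral>\<omega>. exp (- \<mu> * integral {0..t} (\<lambda>s. (b s)^2 / (\<sigma> s)^2 * (X \<alpha> s \<omega>)^2)
                   - \<nu> * (X \<alpha> t \<omega>)^2) \<partial>M)
      = (B_KC K C \<sigma> t) powr ((K - \<alpha>) / 4)
        / sqrt (cosh (D / 2 * L)
                - (\<alpha> - K - 4 * \<nu> * (K * sigma_int \<sigma> t + C)) / D * sinh (D / 2 * L))"
  \<comment> \<open>The grid argument requires \<open>t > 0\<close>. At \<open>t = 0\<close> the
    process vanishes almost surely, and both sides equal 1.\<close>
  proof (cases "t = 0")
    case True
    have [measurable]: "X \<alpha> 0 \<in> borel_measurable M" using Xa tI True by blast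
    have "AE \<omega> in M. X \<alpha> 0 \<omega> = 0"
      using AE_space Xa[THEN conjunct2, THEN conjunct2]
    proof eventually_elim
      case (elim \<omega>)
      then have "X \<alpha> 0 \<omega> = \<sigma> 0 * W 0 \<omega>"
        using bspec[OF elim(2) tI[unfolded True]] by (simp add: wiener_integral_def)
      then show ?case using W elim by (simp add: wiener_process_def)
    qed
    then have "(\<integral>\<omega>. exp (- \<nu> * (X \<alpha> 0 \<omega>)\<^sup>2) \<partial>M) = (\<integral>\<omega>. 1 \<partial>M)"
      by (intro integral_cong_AE) auto
    then show ?thesis using True B0 by (simp add: prob_space)
  next
    case False
    then have t: "t > 0" using t0 by simp
    have \<sigma>_deriv: "(\<sigma> has_real_derivative \<sigma>' s) (at s within {0..t})" if "s \<in> {0..t}" for s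
      using sigma_deriv I_t that by (blast intro: DERIV_subset)
    have \<sigma>_cont: "continuous_on {0..t} \<sigma>" using \<sigma>_deriv by (rule DERIV_continuous_on)
    have \<sigma>'_cont: "continuous_on {0..t} \<sigma>'" using sigma'_cont I_t by (rule continuous_on_subset)
    have \<sigma>_pos: "\<sigma> s > 0" if "s \<in> {0..t}" for s using sigma_pos I_t that by blast
    have S: "(S has_real_derivative (\<sigma> s)\<^sup>2) (at s within {0..t})" if "s \<in> {0..t}" for s
      unfolding S_def sigma_int_def
      by (intro integral_has_real_derivative continuous_intros \<sigma>_cont that)
    have G: "(G has_real_derivative K * (\<sigma> s)\<^sup>2) (at s within {0..t})" if "s \<in> {0..t}" for s
      unfolding G_def by (auto intro!: derivative_eq_intros S that)
    have G_cont: "continuous_on {0..t} G" using G by (rule DERIV_continuous_on)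
    have G_nz: "G s \<noteq> 0" if "s \<in> {0..t}" for s using denom_nz I_t that by (auto simp: G_def S_def)
    \<comment> \<open>A continuous function without zeros keeps its sign on an interval, by the
      intermediate value property.\<close>
    have G_sign: "G s * G r > 0" if "s \<in> {0..t}" "r \<in> {0..t}" for s r
    proof (rule ccontr)
      assume "\<not> G s * G r > 0"
      then have "G s \<le> 0 \<and> 0 \<le> G r \<or> G r \<le> 0 \<and> 0 \<le> G s"
        by (auto simp: zero_less_mult_iff not_less linear)
      moreover have "connected (G ` {0..t})"
        using G_cont by (intro connected_continuous_image) auto
      ultimately have "0 \<in> G ` {0..t}"
        using that connectedD_interval[of "G ` {0..t}" "G s" "G r" 0]
          connectedD_interval[of "G ` {0..t}" "G r" "G s" 0] by blast
      then show False using G_nz by auto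
    qed
    have G0: "G 0 = C" by (simp add: G_def S0)
    have C_nz: "C \<noteq> 0" using G_nz[of 0] t G0 by simp
    have E_eq: "1 + K / C * S s = G s / C" for s using C_nz by (simp add: G_def field_simps)
    \<comment> \<open>This quantity is \<open>G s / G 0\<close>, a quotient of numbers of equal
      sign. Its positivity makes the power in \<open>B_KC\<close> and its logarithm genuine.\<close>
    have E_pos: "1 + K / C * S s > 0" if "s \<in> {0..t}" for s
      using G_sign[OF that, of 0] t unfolding E_eq G0
      by (auto simp: zero_less_mult_iff zero_less_divide_iff)
    have B_pos: "B_KC K C \<sigma> s > 0" if "s \<in> {0..t}" for s
      using E_pos[OF that] by (simp add: B_KC_def S_def)
    have L: "(L has_real_derivative (\<sigma> s)\<^sup>2 / G s) (at s within {0..t})" if s: "s \<in> {0..t}" for s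
    proof (cases "K = 0")
      case True
      then have "L = (\<lambda>s. S s / C)" "G s = C" by (auto simp: L_def B_KC_def S_def G_def)
      then show ?thesis using DERIV_cdivide[OF S[OF s], of C] by simp
    next
      case False
      have E: "((\<lambda>s. 1 + K / C * S s) has_real_derivative K / C * (\<sigma> s)\<^sup>2) (at s within {0..t})"
        using DERIV_add[OF DERIV_const[of 1] DERIV_cmult[OF S[OF s], of "K / C"]]
        by (simp only: add_0_left)
      have "((\<lambda>s. ln (1 + K / C * S s)) has_real_derivative
          1 / (1 + K / C * S s) * (K / C * (\<sigma> s)\<^sup>2)) (at s within {0..t})"
        using DERIV_ln_divide[OF E_pos[OF s]] E by (rule DERIV_chain2)
      from DERIV_cdivide[OF this, of K]
      have "((\<lambda>s. ln (1 + K / C * S s) / K) has_real_derivative (\<sigma> s)\<^sup>2 / G s) (at s within {0..t})"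
        unfolding E_eq using False C_nz by simp
      moreover have "ln (1 + K / C * S s) / K = L s" for s
        using False by (simp add: L_def B_KC_def S_def ln_powr)
      ultimately show ?thesis by simp
    qed
    interpret R: riccati K \<alpha> \<mu> \<nu> t \<sigma> G L
      using \<mu> \<nu> t G L G_sign by unfold_locales
    have l0: "R.l 0 = ln (B_KC K C \<sigma> t)" unfolding R.l_def L0 by (simp add: L_def)
    have b_eq: "b s = (\<sigma> s)\<^sup>2 / (2 * G s)" for s by (simp add: b_def G_def S_def)
    define \<phi> where "\<phi> = (\<lambda>s. \<sigma> s / R.A s)"
    define \<phi>' where "\<phi>' = (\<lambda>s. (\<sigma>' s - \<alpha> * b s * \<sigma> s) / R.A s)"
    \<comment> \<open>As \<open>b = \<sigma>^2 / (2 * G)\<close>, the factor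
      \<open>\<sigma>^2 / (4 * G^2)\<close> is \<open>b^2 / \<sigma>^2\<close>. With
      \<open>X = A * N\<close> this makes \<open>m * N^2\<close> equal to
      \<open>\<mu> * b^2 / \<sigma>^2 * X^2\<close>.\<close>
    define m where "m = (\<lambda>s. \<mu> * ((\<sigma> s)\<^sup>2 / (4 * (G s)\<^sup>2)) * (R.A s)\<^sup>2)"
    have A_nz: "R.A s \<noteq> 0" for s by (simp add: R.A_def)
    have A_deriv: "(R.A has_real_derivative \<alpha> * b s * R.A s) (at s within {0..t})" if "s \<in> {0..t}" for s
      using R.has_derivative_A[OF that] by (simp add: b_eq)
    have A_cont: "continuous_on {0..t} R.A" using A_deriv by (rule DERIV_continuous_on)
    have b_cont: "continuous_on {0..t} (\<lambda>s. \<alpha> * b s)"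
      unfolding b_eq using G_nz by (intro continuous_intros \<sigma>_cont G_cont) auto
    have \<phi>_deriv: "(\<phi> has_real_derivative \<phi>' s) (at s within {0..t})" if "s \<in> {0..t}" for s
    proof -
      have "(\<phi> has_real_derivative (\<sigma>' s * R.A s - \<sigma> s * (\<alpha> * b s * R.A s)) / (R.A s * R.A s))
          (at s within {0..t})"
        unfolding \<phi>_def by (rule DERIV_divide[OF \<sigma>_deriv[OF that] A_deriv[OF that] A_nz])
      also have "(\<sigma>' s * R.A s - \<sigma> s * (\<alpha> * b s * R.A s)) / (R.A s * R.A s) = \<phi>' s"
        using A_nz[of s] by (simp add: \<phi>'_def field_simps)
      finally show ?thesis .
    qed
    have \<phi>'_cont: "continuous_on {0..t} \<phi>'"
      unfolding \<phi>'_def using A_nz by (intro continuous_intros \<sigma>_cont \<sigma>'_cont b_cont A_cont) auto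
    have m_cont: "continuous_on {0..t} m"
      unfolding m_def using G_nz by (intro continuous_intros \<sigma>_cont G_cont A_cont) auto
    have m_pos: "m s > 0" if "s \<in> {0..t}" for s
      unfolding m_def using \<mu> \<sigma>_pos[OF that] G_nz[OF that] A_nz[of s] by simp
    have CM: "(\<integral>\<omega>. exp (- integral {0..t} (\<lambda>s. m s * (wiener_integral \<phi> \<phi>' W s \<omega>)\<^sup>2)
        - R.P t * (wiener_integral \<phi> \<phi>' W t \<omega>)\<^sup>2) \<partial>M)
      = exp (- integral {0..t} (\<lambda>s. (\<phi> s)\<^sup>2 * R.P s))"
      using W I_t t \<phi>_deriv \<phi>'_cont m_cont m_pos
    proof (rule wiener_integral_exp_quadratic)
      fix s assume s: "s \<in> {0..t}"
      show "(R.P has_real_derivative 2 * (\<phi> s)\<^sup>2 * (R.P s)\<^sup>2 - m s) (at s within {0..t})"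
        using R.has_derivative_P[OF s] by (simp add: \<phi>_def m_def)
      show "R.P s \<ge> 0" using s by (rule R.P_nonneg)
    qed

    have X_meas: "X \<alpha> s \<in> borel_measurable M" if "s \<in> {0..t}" for s using Xa I_t that by blast
    have X_cont: "continuous_on {0..t} (\<lambda>s. X \<alpha> s \<omega>)" if "\<omega> \<in> space M" for \<omega>
      using Xa I_t that by (blast intro: continuous_on_subset)
    have W_meas: "W s \<in> borel_measurable M" if "s \<in> {0..t}" for s
      using W I_t that by (auto simp: wiener_process_def)
    have W_cont: "continuous_on {0..t} (\<lambda>s. W s \<omega>)" if "\<omega> \<in> space M" for \<omega>
      using W I_t that by (auto simp: wiener_process_def intro: continuous_on_subset)
    have bs_cont: "continuous_on {0..t} (\<lambda>s. (b s)\<^sup>2 / (\<sigma> s)\<^sup>2)"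
      unfolding b_eq using G_nz \<sigma>_pos by (intro continuous_intros \<sigma>_cont G_cont) force+
    have N_meas: "wiener_integral \<phi> \<phi>' W s \<in> borel_measurable M" if s: "s \<in> {0..t}" for s
    proof (cases "s = 0")
      case True
      then show ?thesis using W_meas[OF s] by (simp add: wiener_integral_def[abs_def])
    next
      case False
      have "(\<lambda>\<omega>. integral {0..s} (\<lambda>r. \<phi>' r * W r \<omega>)) \<in> borel_measurable M"
      proof (rule borel_measurable_integral_continuous_process)
        show "s > 0" using s False by simp
        show "(\<lambda>\<omega>. \<phi>' r * W r \<omega>) \<in> borel_measurable M" if "r \<in> {0..s}" for r
          using that s by (intro borel_measurable_times borel_measurable_const W_meas) auto
        show "continuous_on {0..s} (\<lambda>r. \<phi>' r * W r \<omega>)" if "\<omega> \<in> space M" for \<omega>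
          using s by (intro continuous_intros continuous_on_subset[OF \<phi>'_cont]
              continuous_on_subset[OF W_cont[OF that]]) auto
      qed
      then show ?thesis unfolding wiener_integral_def[abs_def] using W_meas[OF s] by measurable
    qed
    have \<phi>_cont: "continuous_on {0..t} \<phi>" using \<phi>_deriv by (rule DERIV_continuous_on)
    \<comment> \<open>On almost every path the integral equation holds for all times at once, so
      variation of constants applies to that path.\<close>
    have "AE \<omega> in M. exp (- \<mu> * integral {0..t} (\<lambda>s. (b s)^2 / (\<sigma> s)^2 * (X \<alpha> s \<omega>)^2) - \<nu> * (X \<alpha> t \<omega>)^2)
      = exp (- integral {0..t} (\<lambda>s. m s * (wiener_integral \<phi> \<phi>' W s \<omega>)\<^sup>2)
        - R.P t * (wiener_integral \<phi> \<phi>' W t \<omega>)\<^sup>2)"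
      using AE_space Xa[THEN conjunct2, THEN conjunct2]
    proof eventually_elim
      case (elim \<omega>)
      have X_eq: "X \<alpha> s \<omega> = R.A s * wiener_integral \<phi> \<phi>' W s \<omega>" if "s \<in> {0..t}" for s
        unfolding wiener_integral_def \<phi>_def \<phi>'_def
        using A_deriv A_nz b_cont \<sigma>_cont \<sigma>'_cont W_cont[OF elim(1)] X_cont[OF elim(1)]
      proof (rule variation_of_constants)
        show "X \<alpha> r \<omega> = integral {0..r} (\<lambda>u. \<alpha> * b u * X \<alpha> u \<omega>)
            + (\<sigma> r * W r \<omega> - integral {0..r} (\<lambda>u. \<sigma>' u * W u \<omega>))" if "r \<in> {0..t}" for r
          using elim(2) I_t that by (auto simp: wiener_integral_def)
      qed (use that in auto)
      have "integral {0..t} (\<lambda>s. m s * (wiener_integral \<phi> \<phi>' W s \<omega>)\<^sup>2)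
          = integral {0..t} (\<lambda>s. \<mu> * ((b s)\<^sup>2 / (\<sigma> s)\<^sup>2 * (X \<alpha> s \<omega>)\<^sup>2))"
      proof (rule integral_cong)
        fix s assume s: "s \<in> {0..t}"
        show "m s * (wiener_integral \<phi> \<phi>' W s \<omega>)\<^sup>2 = \<mu> * ((b s)\<^sup>2 / (\<sigma> s)\<^sup>2 * (X \<alpha> s \<omega>)\<^sup>2)"
          unfolding X_eq[OF s] m_def b_eq using \<sigma>_pos[OF s]
          by (simp add: power_mult_distrib power_divide power2_eq_square)
      qed
      moreover have "R.P t * (wiener_integral \<phi> \<phi>' W t \<omega>)\<^sup>2 = \<nu> * (X \<alpha> t \<omega>)\<^sup>2"
        using X_eq[of t] t by (simp add: R.P_terminal power_mult_distrib)
      ultimately show ?case by (simp only: integral_mult_right mult_minus_left)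
    qed
    then have "(\<integral>\<omega>. exp (- \<mu> * integral {0..t} (\<lambda>s. (b s)^2 / (\<sigma> s)^2 * (X \<alpha> s \<omega>)^2) - \<nu> * (X \<alpha> t \<omega>)^2) \<partial>M)
      = (\<integral>\<omega>. exp (- integral {0..t} (\<lambda>s. m s * (wiener_integral \<phi> \<phi>' W s \<omega>)\<^sup>2)
        - R.P t * (wiener_integral \<phi> \<phi>' W t \<omega>)\<^sup>2) \<partial>M)"
    proof (rule integral_cong_AE[rotated 2])
      have [measurable]: "(\<lambda>\<omega>. integral {0..t} (\<lambda>s. (b s)\<^sup>2 / (\<sigma> s)\<^sup>2 * (X \<alpha> s \<omega>)\<^sup>2)) \<in> borel_measurable M"
        by (rule borel_measurable_integral_continuous_process[OF t])
          (intro borel_measurable_times borel_measurable_const borel_measurable_power X_meas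
            continuous_on_mult continuous_on_power bs_cont X_cont; assumption)+
      have [measurable]: "X \<alpha> t \<in> borel_measurable M" using X_meas t by simp
      show "(\<lambda>\<omega>. exp (- \<mu> * integral {0..t} (\<lambda>s. (b s)^2 / (\<sigma> s)^2 * (X \<alpha> s \<omega>)^2) - \<nu> * (X \<alpha> t \<omega>)^2))
        \<in> borel_measurable M" by measurable
      have [measurable]: "(\<lambda>\<omega>. integral {0..t} (\<lambda>s. m s * (wiener_integral \<phi> \<phi>' W s \<omega>)\<^sup>2)) \<in> borel_measurable M"
        by (rule borel_measurable_integral_continuous_process[OF t])
          (intro borel_measurable_times borel_measurable_const borel_measurable_power N_meas
            continuous_on_mult continuous_on_power m_cont continuous_on_wiener_integral \<phi>_cont \<phi>'_cont W_cont; assumption)+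
      have [measurable]: "wiener_integral \<phi> \<phi>' W t \<in> borel_measurable M" using N_meas t by simp
      show "(\<lambda>\<omega>. exp (- integral {0..t} (\<lambda>s. m s * (wiener_integral \<phi> \<phi>' W s \<omega>)\<^sup>2)
        - R.P t * (wiener_integral \<phi> \<phi>' W t \<omega>)\<^sup>2)) \<in> borel_measurable M" by measurable
    qed
    also have "\<dots> = exp (- R.\<kappa> / 4 * R.l 0) / sqrt (R.u 0)"
      unfolding CM unfolding \<phi>_def by (rule R.exp_integral_P)
    also have "exp (- R.\<kappa> / 4 * R.l 0) = (B_KC K C \<sigma> t) powr ((K - \<alpha>) / 4)"
    proof -
      have "B_KC K C \<sigma> t \<noteq> 0" using B_pos[of t] t by simp
      then show ?thesis by (simp add: powr_def R.\<kappa>_def l0)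
    qed
    finally show ?thesis
      unfolding Let_def R.u_def l0 R.D_def R.\<kappa>_def unfolding G_def S_def .
  qed
qed

end
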